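(* Let $m\ge2$, let $f\colon(X,x_0)\to(Y,y_0)$ be a map, and for $1\le i\le m$ let $\iota_i\colon X^{m-1}\to X^m$ be the map $\iota_i(x_1,\dots,x_{m-1})=(x_1,\dots,x_{i-1},x_0,x_i,\dots,x_{m-1})$. Then $$\mathsf{cat}(f^{m-1})\le\mathsf{D}(f^m\circ\iota_1,\dots,f^m\circ\iota_m)\quad\text{and}\quad\mathsf{dcat}(f^{m-1})\le\mathsf{dD}(f^m\circ\iota_1,\dots,f^m\circ\iota_m),$$ where $f^r\colon X^r\to Y^r$ is the power map. In particular, $\mathsf{cat}(X^{m-1})=\mathsf{D}(\iota_1,\dots,\iota_m)$ and $\mathsf{dcat}(X^{m-1})=\mathsf{dD}(\iota_1,\dots,\iota_m)$.
   Context: For a fibration $p\colon E\to B$, $\mathsf{secat}(p)$ is the least $n\ge 0$ such that $B$ is covered by $n+1$ open sets over each of which $p$ has a continuous partial section. For $k\ge1$ let $E_k(p)$ be the space of probability measures $\sum_{i=1}^k\lambda_ie_i$ on $E$ supported on at most $k$ points, all in a single fiber of $p$, as a subspace of the space $\mathcal B_k(E)$ of probability measures with support of size at most $k$ (with the L\'evy--Prokhorov metric topology when $E$ is metrizable; the results are asserted equally for the quotient topology from the symmetric join $\ast^kE/\Sigma_k$), and $p_k\colon E_k(p)\to B$, $p_k(\sum\lambda_ie_i)=p(e_i)$. $\mathsf{dsecat}(p)$ is the least $n\ge0$ such that $p_{n+1}$ has a continuous section. Fix times $0=t_1<\dots<t_m=1$ and let $\pi^Z_m\colon Z^I\to Z^m$,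 $\gamma\mapsto(\gamma(t_1),\dots,\gamma(t_m))$. For maps $g_1,\dots,g_m\colon W\to Z$ with $(g_1,\dots,g_m)(w)=(g_1(w),\dots,g_m(w))$: $\mathsf{D}(g_1,\dots,g_m)$ is the least $n\ge0$ such that $W$ is covered by $n+1$ open sets on each of which the restrictions of all the $g_i$ are mutually homotopic; equivalently $\mathsf{secat}((g_1,\dots,g_m)^*\pi^Z_m)$. $\mathsf{dD}(g_1,\dots,g_m):=\mathsf{dsecat}((g_1,\dots,g_m)^*\pi^Z_m)$. With $P_0(Y)\subset Y^I$ the paths ending at $y_0$ and $p^Y_m\colon P_0(Y)\to Y^{m-1}$, $\gamma\mapsto(\gamma(t_1),\dots,\gamma(t_{m-1}))$: $\mathsf{cat}(f^{m-1}):=\mathsf{secat}((f^{m-1})^*p^Y_m)$ and $\mathsf{dcat}(f^{m-1}):=\mathsf{dsecat}((f^{m-1})^*p^Y_m)$ (the Lusternik--Schnirelmann category, resp. distributional category, of the map $f^{m-1}$); $\mathsf{cat}(X^{m-1})$, $\mathsf{dcat}(X^{m-1})$ are the values for $f=\mathrm{id}_X$. *)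

theory Defs
  imports "HOL-Probability.Probability"
begin

section \<open>Powers, path spaces, pullbacks\<close>

text \<open>Points of the power \<open>X\<^sup>r\<close> are functions that are extensional on the index set \<open>{1..r}\<close>.\<close>

definition power_top :: "nat \<Rightarrow> 'a topology \<Rightarrow> (nat \<Rightarrow> 'a) topology" where
  "power_top r X = product_topology (\<lambda>_. X) {1..r}"

definition power_map :: "nat \<Rightarrow> ('a \<Rightarrow> 'b) \<Rightarrow> (nat \<Rightarrow> 'a) \<Rightarrow> nat \<Rightarrow> 'b" where
  "power_map r f x = (\<lambda>i\<in>{1..r}. f (x i))"

definition tuple_map :: "nat \<Rightarrow> (nat \<Rightarrow> 'w \<Rightarrow> 'z) \<Rightarrow> 'w \<Rightarrow> nat \<Rightarrow> 'z" where
  "tuple_map m g w = (\<lambda>i\<in>{1..m}. g i w)"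

text \<open>Paths are made extensional on the unit interval, so that equality of paths is equality of
  functions; the topology is the compact-open one.\<close>

definition paths :: "'z topology \<Rightarrow> (real \<Rightarrow> 'z) set" where
  "paths Z = {\<gamma> \<in> extensional {0..1}. pathin Z \<gamma>}"

definition path_space :: "'z topology \<Rightarrow> (real \<Rightarrow> 'z) topology" where
  "path_space Z = topology_generated_by
     {{\<gamma> \<in> paths Z. \<gamma> ` K \<subseteq> U} | K U. compact K \<and> K \<subseteq> {0..1} \<and> openin Z U}"

lemma topspace_path_space: "topspace (path_space Z) = paths Z"
proof -
  have "paths Z = {\<gamma> \<in> paths Z. \<gamma> ` {} \<subseteq> {}}" by simp
  then have "paths Z \<in> {{\<gamma> \<in> paths Z. \<gamma> ` K \<subseteq> U} | K U. compact K \<and> K \<subseteq> {0..1} \<and> openin Z U}"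
    by (intro CollectI exI[of _ "{}"]) auto
  then show ?thesis
    unfolding path_space_def topology_generated_by_topspace by blast
qed

definition path_space_to :: "'z topology \<Rightarrow> 'z \<Rightarrow> (real \<Rightarrow> 'z) topology" where
  "path_space_to Z z0 = subtopology (path_space Z) {\<gamma>. \<gamma> 1 = z0}"

definition eval_at :: "nat \<Rightarrow> (nat \<Rightarrow> real) \<Rightarrow> (real \<Rightarrow> 'z) \<Rightarrow> nat \<Rightarrow> 'z" where
  "eval_at r t \<gamma> = (\<lambda>i\<in>{1..r}. \<gamma> (t i))"

text \<open>The total space of the pullback of \<open>p : E \<rightarrow> Z\<close> along \<open>g : W \<rightarrow> Z\<close>; the projection to \<open>W\<close>
  is \<open>fst\<close>.\<close>

definition pullback_top ::
  "'w topology \<Rightarrow> ('w \<Rightarrow> 'z) \<Rightarrow> 'e topology \<Rightarrow> ('e \<Rightarrow> 'z) \<Rightarrow> ('w \<times> 'e) topology" where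
  "pullback_top W g E p = subtopology (prod_topology W E) {(w, e). g w = p e}"

section \<open>Sectional category\<close>

text \<open>Infima are taken in \<^typ>\<open>enat\<close>: the value is \<open>\<infinity>\<close> when no \<open>n\<close> qualifies.\<close>

definition secat :: "'e topology \<Rightarrow> 'b topology \<Rightarrow> ('e \<Rightarrow> 'b) \<Rightarrow> enat" where
  "secat E B p = Inf {enat n | n. \<exists>U :: nat \<Rightarrow> 'b set.
     (\<Union>i\<in>{0..n}. U i) = topspace B \<and>
     (\<forall>i\<in>{0..n}. openin B (U i) \<and>
        (\<exists>s. continuous_map (subtopology B (U i)) E s \<and> (\<forall>b\<in>U i. p (s b) = b)))}"

section \<open>Finitely supported probability measures\<close>

definition fin_measures :: "nat \<Rightarrow> 'e set \<Rightarrow> 'e pmf set" where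
  "fin_measures k M = {\<mu>. set_pmf \<mu> \<subseteq> M \<and> finite (set_pmf \<mu>) \<and> card (set_pmf \<mu>) \<le> k}"

definition thickening :: "'e metric \<Rightarrow> 'e set \<Rightarrow> real \<Rightarrow> 'e set" where
  "thickening m A \<epsilon> = {x \<in> mspace m. \<exists>a\<in>A. mdist m a x < \<epsilon>}"

definition lp_dist :: "'e metric \<Rightarrow> 'e pmf \<Rightarrow> 'e pmf \<Rightarrow> real" where
  "lp_dist m \<mu> \<nu> = Inf {\<epsilon>. \<epsilon> > 0 \<and>
     (\<forall>A \<in> sigma_sets (mspace m) {U. openin (mtopology_of m) U}.
        measure_pmf.prob \<mu> A \<le> measure_pmf.prob \<nu> (thickening m A \<epsilon>) + \<epsilon> \<and>
        measure_pmf.prob \<nu> A \<le> measure_pmf.prob \<mu> (thickening m A \<epsilon>) + \<epsilon>)}"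

text \<open>Meaningful only for metrizable \<open>E\<close>. The topology of the Levy--Prokhorov distance does not
  depend on the metric chosen for \<open>E\<close>.\<close>

definition lp_top :: "nat \<Rightarrow> 'e topology \<Rightarrow> 'e pmf topology" where
  "lp_top k E = Metric_space.mtopology (fin_measures k (topspace E))
     (lp_dist (SOME m. mtopology_of m = E))"

definition simplex_top :: "nat \<Rightarrow> (nat \<Rightarrow> real) topology" where
  "simplex_top k = subtopology (power_top k euclideanreal)
     {c. (\<forall>i\<in>{1..k}. 0 \<le> c i) \<and> (\<Sum>i\<in>{1..k}. c i) = 1}"

text \<open>The measure \<open>\<Sum>i\<le>k. c i \<cdot> e i\<close>.\<close>

definition comb_pmf :: "nat \<Rightarrow> (nat \<Rightarrow> real) \<times> (nat \<Rightarrow> 'e) \<Rightarrow> 'e pmf" where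
  "comb_pmf k = (\<lambda>(c, e). embed_pmf (\<lambda>x. \<Sum>i\<in>{1..k}. if e i = x then c i else 0))"

text \<open>The join of \<open>k\<close> copies of \<open>E\<close>, its quotient by the symmetric group, and the space of measures
  (where in addition equal points are amalgamated) are successive quotients of
  \<open>\<Delta>\<^bsup>k-1\<^esup> \<times> E\<^sup>k\<close>; hence the quotient topology is the one coinduced from that product.\<close>

definition join_top :: "nat \<Rightarrow> 'e topology \<Rightarrow> 'e pmf topology" where
  "join_top k E = topology (\<lambda>V. V \<subseteq> fin_measures k (topspace E) \<and>
     openin (prod_topology (simplex_top k) (power_top k E))
       {z \<in> topspace (prod_topology (simplex_top k) (power_top k E)). comb_pmf k z \<in> V})"

lemma openin_join_top:
  "openin (join_top k E) V \<longleftrightarrow> V \<subseteq> fin_measures k (topspace E) \<and>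
     openin (prod_topology (simplex_top k) (power_top k E))
       {z \<in> topspace (prod_topology (simplex_top k) (power_top k E)). comb_pmf k z \<in> V}"
proof -
  let ?D = "prod_topology (simplex_top k) (power_top k E)"
  have I: "{z \<in> topspace ?D. comb_pmf k z \<in> S \<inter> T} =
      {z \<in> topspace ?D. comb_pmf k z \<in> S} \<inter> {z \<in> topspace ?D. comb_pmf k z \<in> T}" for S T
    by blast
  have U: "{z \<in> topspace ?D. comb_pmf k z \<in> \<Union>K} =
      (\<Union>V\<in>K. {z \<in> topspace ?D. comb_pmf k z \<in> V})" for K
    by blast
  have "istopology (\<lambda>V. V \<subseteq> fin_measures k (topspace E) \<and>
     openin ?D {z \<in> topspace ?D. comb_pmf k z \<in> V})"
    unfolding istopology_def I U by (auto intro!: openin_Int openin_Union)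
  then show ?thesis
    unfolding join_top_def by (subst topology_inverse') simp_all
qed

datatype measure_topology = Levy_Prokhorov | Symmetric_Join

fun measure_top :: "measure_topology \<Rightarrow> nat \<Rightarrow> 'e topology \<Rightarrow> 'e pmf topology" where
  "measure_top Levy_Prokhorov k E = lp_top k E"
| "measure_top Symmetric_Join k E = join_top k E"

definition admissible :: "measure_topology \<Rightarrow> 'e topology \<Rightarrow> bool" where
  "admissible \<tau> E \<longleftrightarrow> (\<tau> = Levy_Prokhorov \<longrightarrow> metrizable_space E)"

section \<open>Distributional sectional category\<close>

definition fibre_measures :: "measure_topology \<Rightarrow> nat \<Rightarrow> 'e topology \<Rightarrow> 'b topology \<Rightarrow> ('e \<Rightarrow> 'b)
    \<Rightarrow> 'e pmf topology" where
  "fibre_measures \<tau> k E B p = subtopology (measure_top \<tau> k E)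
     {\<mu> \<in> fin_measures k (topspace E). \<exists>b\<in>topspace B. \<forall>e\<in>set_pmf \<mu>. p e = b}"

definition fibre_proj :: "('e \<Rightarrow> 'b) \<Rightarrow> 'e pmf \<Rightarrow> 'b" where
  "fibre_proj p \<mu> = (THE b. \<forall>e\<in>set_pmf \<mu>. p e = b)"

definition dsecat :: "measure_topology \<Rightarrow> 'e topology \<Rightarrow> 'b topology \<Rightarrow> ('e \<Rightarrow> 'b) \<Rightarrow> enat" where
  "dsecat \<tau> E B p = Inf {enat n | n. \<exists>s.
     continuous_map B (fibre_measures \<tau> (n + 1) E B p) s \<and>
     (\<forall>b\<in>topspace B. fibre_proj p (s b) = b)}"

section \<open>Homotopic distance and category of power maps\<close>

definition hdist :: "nat \<Rightarrow> 'w topology \<Rightarrow> 'z topology \<Rightarrow> (nat \<Rightarrow> 'w \<Rightarrow> 'z) \<Rightarrow> enat" where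
  "hdist m W Z g = Inf {enat n | n. \<exists>U :: nat \<Rightarrow> 'w set.
     (\<Union>l\<in>{0..n}. U l) = topspace W \<and>
     (\<forall>l\<in>{0..n}. openin W (U l) \<and>
        (\<forall>i\<in>{1..m}. \<forall>j\<in>{1..m}.
           homotopic_with (\<lambda>_. True) (subtopology W (U l)) Z (g i) (g j)))}"

definition dist_total :: "(nat \<Rightarrow> real) \<Rightarrow> nat \<Rightarrow> 'w topology \<Rightarrow> 'z topology \<Rightarrow> (nat \<Rightarrow> 'w \<Rightarrow> 'z)
    \<Rightarrow> ('w \<times> (real \<Rightarrow> 'z)) topology" where
  "dist_total t m W Z g = pullback_top W (tuple_map m g) (path_space Z) (eval_at m t)"

definition dhdist :: "measure_topology \<Rightarrow> (nat \<Rightarrow> real) \<Rightarrow> nat \<Rightarrow> 'w topology \<Rightarrow> 'z topology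
    \<Rightarrow> (nat \<Rightarrow> 'w \<Rightarrow> 'z) \<Rightarrow> enat" where
  "dhdist \<tau> t m W Z g = dsecat \<tau> (dist_total t m W Z g) W fst"

text \<open>Here and below the invariants are those of \<open>f\<^bsup>m-1\<^esup> : X\<^bsup>m-1\<^esup> \<rightarrow> Y\<^bsup>m-1\<^esup>\<close>.\<close>

definition cat_total :: "(nat \<Rightarrow> real) \<Rightarrow> nat \<Rightarrow> 'a topology \<Rightarrow> 'b topology \<Rightarrow> 'b \<Rightarrow> ('a \<Rightarrow> 'b)
    \<Rightarrow> ((nat \<Rightarrow> 'a) \<times> (real \<Rightarrow> 'b)) topology" where
  "cat_total t m X Y y0 f = pullback_top (power_top (m - 1) X) (power_map (m - 1) f)
     (path_space_to Y y0) (eval_at (m - 1) t)"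

definition cat_power :: "(nat \<Rightarrow> real) \<Rightarrow> nat \<Rightarrow> 'a topology \<Rightarrow> 'b topology \<Rightarrow> 'b \<Rightarrow> ('a \<Rightarrow> 'b)
    \<Rightarrow> enat" where
  "cat_power t m X Y y0 f = secat (cat_total t m X Y y0 f) (power_top (m - 1) X) fst"

definition dcat_power :: "measure_topology \<Rightarrow> (nat \<Rightarrow> real) \<Rightarrow> nat \<Rightarrow> 'a topology \<Rightarrow> 'b topology
    \<Rightarrow> 'b \<Rightarrow> ('a \<Rightarrow> 'b) \<Rightarrow> enat" where
  "dcat_power \<tau> t m X Y y0 f = dsecat \<tau> (cat_total t m X Y y0 f) (power_top (m - 1) X) fst"

definition insert_pt :: "nat \<Rightarrow> 'a \<Rightarrow> nat \<Rightarrow> (nat \<Rightarrow> 'a) \<Rightarrow> nat \<Rightarrow> 'a" where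
  "insert_pt m x0 i x = (\<lambda>j\<in>{1..m}. if j < i then x j else if j = i then x0 else x (j - 1))"

end

theory Submission
  imports Defs
begin

text \<open>Put \<open>W = X\<^sup>m\<^sup>-\<^sup>1\<close> and \<open>g\<^sub>i = f\<^sup>m \<circ> \<iota>\<^sub>i\<close>. Both sides of every assertion are invariants of a
  space over \<open>W\<close>: the total space \<^const>\<open>cat_total\<close> of pairs \<open>(x, \<gamma>)\<close> with \<open>\<gamma>(t\<^sub>j) = f(x\<^sub>j)\<close> for \<open>j < m\<close> and
  \<open>\<gamma>(1) = y\<^sub>0\<close>, and the total space \<^const>\<open>dist_total\<close> of pairs \<open>(x, \<Gamma>)\<close> with \<open>\<Gamma>\<close> a path in \<open>Y\<^sup>m\<close> and
  \<open>\<Gamma>(t\<^sub>i) = g\<^sub>i(x)\<close>. There are continuous maps over \<open>W\<close> in both directions between the two, and this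
  for every \<open>f\<close>, so that the inequalities are in fact equalities.

  Towards \<^const>\<open>cat_total\<close>: the \<open>j\<close>-th coordinate of \<open>g\<^sub>i(x)\<close> is \<open>f(x\<^sub>j)\<close>, \<open>y\<^sub>0\<close> or \<open>f(x\<^sub>j\<^sub>-\<^sub>1)\<close> according to whether
  \<open>i > j\<close>, \<open>i = j\<close> or \<open>i < j\<close>. So the coordinate path \<open>\<Gamma>\<^sub>j\<^sub>+\<^sub>1\<close> runs from \<open>f(x\<^sub>j)\<close> at time \<open>t\<^sub>j\<close> through \<open>y\<^sub>0\<close>
  at time \<open>t\<^sub>j\<^sub>+\<^sub>1\<close> to \<open>f(x\<^sub>j\<^sub>+\<^sub>1)\<close> at time \<open>t\<^sub>j\<^sub>+\<^sub>2\<close>; these pieces, with the last one stopped at \<open>y\<^sub>0\<close>, are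
  concatenated (\<open>dist_total_to_cat_total\<close>). Towards \<^const>\<open>dist_total\<close>: every \<open>\<Gamma>\<^sub>j\<close> only has to visit
  points that \<open>\<gamma>\<close> visits as well, so a reparametrization \<open>\<Gamma>\<^sub>j = \<gamma> \<circ> \<phi>\<^sub>j\<close> will do
  (\<open>cat_total_to_dist_total\<close>).

  A map over the base transports sections, hence bounds \<^const>\<open>secat\<close>; it also pushes finitely supported
  measures forward continuously, hence bounds \<^const>\<open>dsecat\<close>. For the quotient topology the continuity
  is formal. For the Levy--Prokhorov distance it rests on the finiteness of the support of the
  measure at which continuity is tested: a continuous map is equally well behaved near all the
  points of a finite set (\<open>lp_close_pushforward\<close>).

  Finally \<^const>\<open>hdist\<close>, which is defined by homotopies, is the sectional category of
  \<^const>\<open>dist_total\<close> (\<open>hdist_eq_secat\<close>), by the exponential law for paths.\<close>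

section \<open>Path spaces and pullbacks\<close>

text \<open>The evaluation \<open>(\<gamma>, s) \<mapsto> \<gamma>(s)\<close> is continuous because the unit interval is locally compact: a path
  that sends \<open>s\<close> into \<open>V\<close> sends a compact neighbourhood of \<open>s\<close> into \<open>V\<close>, and that is a subbasic open condition.\<close>

lemma continuous_map_path_eval:
  assumes G: "continuous_map A (path_space Z) G" and r: "continuous_map A (top_of_set {0..1}) r"
  shows "continuous_map A Z (\<lambda>a. G a (r a))"
proof -
  let ?I = "top_of_set {0..1::real}"
  have "continuous_map (prod_topology (path_space Z) ?I) Z (\<lambda>(\<gamma>, s). \<gamma> s)"
    unfolding continuous_map_eq_topcontinuous_at topcontinuous_at_def
  proof (intro ballI conjI allI impI; clarsimp simp: topspace_path_space)
    fix \<gamma> and s :: real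
    assume \<gamma>: "\<gamma> \<in> paths Z" and s: "0 \<le> s" "s \<le> 1"
    then show "\<gamma> s \<in> topspace Z"
      by (auto simp: paths_def pathin_def continuous_map_def Pi_iff)
  next
    fix \<gamma> and s :: real and V
    assume \<gamma>: "\<gamma> \<in> paths Z" and s: "0 \<le> s" "s \<le> 1" and V: "openin Z V" "\<gamma> s \<in> V"
    have "openin ?I {x \<in> {0..1}. \<gamma> x \<in> V}"
      using \<gamma> V(1) by (auto simp: paths_def pathin_def continuous_map_def)
    then obtain e where e: "e > 0" "\<And>x. x \<in> {0..1} \<Longrightarrow> dist x s \<le> e \<Longrightarrow> \<gamma> x \<in> V"
      using s V(2) unfolding openin_contains_cball
      by (auto simp: subset_iff dist_commute)
    let ?P = "{\<gamma> \<in> paths Z. \<gamma> ` ({0..1} \<inter> cball s e) \<subseteq> V}"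
    have "openin (path_space Z) ?P"
      unfolding path_space_def using V(1)
      by (intro topology_generated_by_Basis) (auto intro!: compact_Int_closed)
    moreover have "openin ?I ({0..1} \<inter> ball s e)"
      by (simp add: openin_open_Int)
    ultimately have "openin (prod_topology (path_space Z) ?I) (?P \<times> ({0..1} \<inter> ball s e))"
      by (simp add: openin_prod_Times_iff)
    moreover have "(\<gamma>, s) \<in> ?P \<times> ({0..1} \<inter> ball s e)"
      using e \<gamma> s by (auto simp: dist_commute)
    ultimately show "\<exists>U. openin (prod_topology (path_space Z) ?I) U \<and> (\<gamma>, s) \<in> U \<and>
        (\<forall>x\<in>U. (case x of (\<gamma>, s) \<Rightarrow> \<gamma> s) \<in> V)"
      by (intro exI[of _ "?P \<times> ({0..1} \<inter> ball s e)"]) (auto simp: image_subset_iff)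
  qed
  moreover have "continuous_map A (prod_topology (path_space Z) ?I) (\<lambda>a. (G a, r a))"
    using G r by (simp add: continuous_map_paired)
  ultimately have "continuous_map A Z ((\<lambda>(\<gamma>, s). \<gamma> s) \<circ> (\<lambda>a. (G a, r a)))"
    by (rule continuous_map_compose[rotated])
  then show ?thesis by (simp add: o_def)
qed

text \<open>The other half of the exponential law: the parameters \<open>v\<close> for which
  \<open>H(\<cdot>, v)\<close> sends the compact set \<open>K\<close> into \<open>U\<close> are the complement of the projection of a closed subset
  of \<open>K \<times> V\<close>, and projecting off a compact factor is a closed map.\<close>

lemma continuous_map_path_curry:
  assumes H: "continuous_map (prod_topology (top_of_set {0..1}) V) Z H"
  shows "continuous_map V (path_space Z) (\<lambda>v. \<lambda>s\<in>{0..1}. H (s, v))"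
proof -
  let ?I = "top_of_set {0..1::real}"
  let ?c = "\<lambda>v. \<lambda>s\<in>{0..1}. H (s, v)"
  have paths: "?c v \<in> paths Z" if v: "v \<in> topspace V" for v
  proof -
    have "continuous_map ?I (prod_topology ?I V) (\<lambda>s. (s, v))"
      using v by (simp add: continuous_map_paired)
    then have "continuous_map ?I Z (H \<circ> (\<lambda>s. (s, v)))"
      using H by (rule continuous_map_compose)
    then have "continuous_map ?I Z (?c v)"
      by (rule continuous_map_eq) auto
    then show ?thesis by (auto simp: paths_def pathin_def)
  qed
  show ?thesis
    unfolding path_space_def
  proof (rule continuous_on_generated_topo)
    fix S assume "S \<in> {{\<gamma> \<in> paths Z. \<gamma> ` K \<subseteq> U} | K U. compact K \<and> K \<subseteq> {0..1} \<and> openin Z U}"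
    then obtain K U where S: "S = {\<gamma> \<in> paths Z. \<gamma> ` K \<subseteq> U}"
      and K: "compact K" "K \<subseteq> {0..1}" and U: "openin Z U" by blast
    have "continuous_map (top_of_set K) ?I id"
      using K(2) by (auto simp: continuous_map_in_subtopology)
    then have "continuous_map (prod_topology (top_of_set K) V) ?I (id \<circ> fst)"
      by (rule continuous_map_compose[OF continuous_map_fst])
    then have "continuous_map (prod_topology (top_of_set K) V) (prod_topology ?I V) (\<lambda>z. z)"
      using continuous_map_snd[of "top_of_set K" V]
      by (simp add: continuous_map_pairwise o_def)
    then have "continuous_map (prod_topology (top_of_set K) V) Z (H \<circ> (\<lambda>z. z))"
      using H by (rule continuous_map_compose)
    then have HK: "continuous_map (prod_topology (top_of_set K) V) Z H"
      by (simp add: o_def)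
    define C where "C = {z \<in> topspace (prod_topology (top_of_set K) V). H z \<in> topspace Z - U}"
    have "closedin (prod_topology (top_of_set K) V) C"
      unfolding C_def using HK U by (intro closedin_continuous_map_preimage) auto
    moreover have "closed_map (prod_topology (top_of_set K) V) V snd"
      using K(1) by (intro Abstract_Topological_Spaces.closed_map_snd) (simp add: compact_space_subtopology)
    ultimately have "closedin V (snd ` C)"
      by (auto simp: closed_map_def)
    moreover have "?c -` S \<inter> topspace V = topspace V - snd ` C"
    proof (intro equalityI subsetI)
      fix v assume "v \<in> ?c -` S \<inter> topspace V"
      then show "v \<in> topspace V - snd ` C" using K(2) by (force simp: S C_def)
    next
      fix v assume v: "v \<in> topspace V - snd ` C"
      have "H (s, v) \<in> U" if "s \<in> K" for s
      proof (rule ccontr)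
        assume "H (s, v) \<notin> U"
        moreover have "(s, v) \<in> topspace (prod_topology (top_of_set K) V)" using v that by auto
        moreover from this have "H (s, v) \<in> topspace Z"
          using HK by (auto simp: continuous_map_def)
        ultimately have "(s, v) \<in> C" by (auto simp: C_def)
        then show False using v by force
      qed
      then show "v \<in> ?c -` S \<inter> topspace V"
        using paths v K(2) by (auto simp: S)
    qed
    ultimately show "openin V (?c -` S \<inter> topspace V)" by auto
  next
    have "paths Z \<in> {{\<gamma> \<in> paths Z. \<gamma> ` K \<subseteq> U} | K U. compact K \<and> K \<subseteq> {0..1} \<and> openin Z U}"
      by (intro CollectI exI[of _ "{}"]) auto
    then show "?c ` topspace V \<subseteq> \<Union> {{\<gamma> \<in> paths Z. \<gamma> ` K \<subseteq> U} | K U. compact K \<and> K \<subseteq> {0..1} \<and> openin Z U}"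
      using paths by blast
  qed
qed

lemma continuous_map_into_pullback:
  assumes "continuous_map V W u" "continuous_map V E q"
    and "\<And>v. v \<in> topspace V \<Longrightarrow> g (u v) = p (q v)"
  shows "continuous_map V (pullback_top W g E p) (\<lambda>v. (u v, q v))"
  unfolding pullback_top_def using assms
  by (auto intro!: continuous_map_into_subtopology simp: continuous_map_paired)

lemma continuous_map_pullback_fst: "continuous_map (pullback_top W g E p) W fst"
  and continuous_map_pullback_snd: "continuous_map (pullback_top W g E p) E snd"
  unfolding pullback_top_def
  by (intro continuous_map_from_subtopology continuous_map_fst continuous_map_snd)+

lemma topspace_pullback:
  "topspace (pullback_top W g E p) = {(w, e). w \<in> topspace W \<and> e \<in> topspace E \<and> g w = p e}"
  by (auto simp: pullback_top_def)

lemma tuple_map_eq_eval_at_iff: "tuple_map m g w = eval_at m t \<gamma> \<longleftrightarrow> (\<forall>i\<in>{1..m}. \<gamma> (t i) = g i w)"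
  unfolding tuple_map_def eval_at_def by (auto simp: restrict_def fun_eq_iff)

lemma power_map_eq_eval_at_iff: "power_map m f x = eval_at m t \<gamma> \<longleftrightarrow> (\<forall>i\<in>{1..m}. \<gamma> (t i) = f (x i))"
  unfolding power_map_def eval_at_def by (auto simp: restrict_def fun_eq_iff)

lemma topspace_dist_total:
  "topspace (dist_total t m W Z g) =
     {(w, \<gamma>). w \<in> topspace W \<and> \<gamma> \<in> paths Z \<and> (\<forall>i\<in>{1..m}. \<gamma> (t i) = g i w)}"
  by (auto simp: dist_total_def topspace_pullback topspace_path_space tuple_map_eq_eval_at_iff)

lemma topspace_cat_total:
  "topspace (cat_total t m X Y y0 f) =
     {(x, \<gamma>). x \<in> topspace (power_top (m - 1) X) \<and> \<gamma> \<in> paths Y \<and> \<gamma> 1 = y0 \<and>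
        (\<forall>i\<in>{1..m - 1}. \<gamma> (t i) = f (x i))}"
  by (auto simp: cat_total_def topspace_pullback topspace_path_space path_space_to_def
      power_map_eq_eval_at_iff)

section \<open>Push-forward in the quotient topology\<close>

text \<open>The measure \<open>\<Sum> c\<^sub>i e\<^sub>i\<close> is the image under \<open>e\<close> of the measure on the indices with weights \<open>c\<close>, which
  reduces the naturality of \<^const>\<open>comb_pmf\<close> to functoriality of \<^const>\<open>map_pmf\<close>.\<close>

definition weights_pmf :: "nat \<Rightarrow> (nat \<Rightarrow> real) \<Rightarrow> nat pmf" where
  "weights_pmf k c = embed_pmf (\<lambda>i. if i \<in> {1..k} then c i else 0)"

lemma topspace_simplex_top:
  "c \<in> topspace (simplex_top k) \<longleftrightarrow> c \<in> extensional {1..k} \<and> (\<forall>i\<in>{1..k}. 0 \<le> c i) \<and> (\<Sum>i\<in>{1..k}. c i) = 1"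
  by (auto simp: simplex_top_def power_top_def PiE_def)

lemma pmf_weights:
  assumes c: "c \<in> topspace (simplex_top k)"
  shows "pmf (weights_pmf k c) i = (if i \<in> {1..k} then c i else 0)"
  unfolding weights_pmf_def
proof (rule pmf_embed_pmf)
  show "0 \<le> (if i \<in> {1..k} then c i else 0)" for i
    using c by (auto simp: topspace_simplex_top)
  have "(\<integral>\<^sup>+ i. ennreal (if i \<in> {1..k} then c i else 0) \<partial>count_space UNIV) = (\<Sum>i\<in>{1..k}. ennreal (c i))"
    by (subst nn_integral_count_space'[of "{1..k}"]) auto
  also have "\<dots> = 1"
    using c by (subst sum_ennreal) (auto simp: topspace_simplex_top)
  finally show "(\<integral>\<^sup>+ i. ennreal (if i \<in> {1..k} then c i else 0) \<partial>count_space UNIV) = 1" .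
qed

lemma set_weights_pmf:
  assumes "c \<in> topspace (simplex_top k)"
  shows "set_pmf (weights_pmf k c) \<subseteq> {1..k}"
  using pmf_weights[OF assms] by (auto simp: set_pmf_eq split: if_splits)

lemma embed_pmf_pmf: "embed_pmf (pmf p) = p"
  by (rule type_definition.Rep_inverse[OF td_pmf_embed_pmf])

lemma comb_pmf_eq_map_pmf:
  assumes c: "c \<in> topspace (simplex_top k)"
  shows "comb_pmf k (c, e) = map_pmf e (weights_pmf k c)"
proof -
  have "pmf (map_pmf e (weights_pmf k c)) x = (\<Sum>i\<in>{1..k}. if e i = x then c i else 0)" for x
  proof -
    have "pmf (map_pmf e (weights_pmf k c)) x = measure (weights_pmf k c) (e -` {x} \<inter> {1..k})"
      unfolding pmf_map using set_weights_pmf[OF c]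
      by (intro measure_prob_cong_0) (auto simp: pmf_weights[OF c])
    also have "\<dots> = (\<Sum>i\<in>e -` {x} \<inter> {1..k}. c i)"
      by (simp add: measure_measure_pmf_finite pmf_weights[OF c])
    also have "\<dots> = (\<Sum>i\<in>{1..k}. if e i = x then c i else 0)"
      by (simp add: sum.If_cases Int_commute vimage_def)
    finally show ?thesis .
  qed
  then have "(\<lambda>x. \<Sum>i\<in>{1..k}. if e i = x then c i else 0) = pmf (map_pmf e (weights_pmf k c))"
    by (simp add: fun_eq_iff)
  then show ?thesis
    unfolding comb_pmf_def by (simp add: embed_pmf_pmf)
qed

lemma comb_pmf_power_map:
  assumes "c \<in> topspace (simplex_top k)"
  shows "comb_pmf k (c, power_map k F e) = map_pmf F (comb_pmf k (c, e))"
  unfolding comb_pmf_eq_map_pmf[OF assms] pmf.map_comp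
  by (rule map_pmf_cong) (use set_weights_pmf[OF assms] in \<open>auto simp: power_map_def\<close>)

lemma fin_measures_map_pmf:
  assumes \<mu>: "\<mu> \<in> fin_measures k S" and F: "F ` S \<subseteq> T"
  shows "map_pmf F \<mu> \<in> fin_measures k T"
  using \<mu> F card_image_le[of "set_pmf \<mu>" F] by (auto simp: fin_measures_def)

lemma comb_pmf_in_fin_measures:
  assumes "z \<in> topspace (prod_topology (simplex_top k) (power_top k E))"
  shows "comb_pmf k z \<in> fin_measures k (topspace E)"
proof -
  obtain c e where z: "z = (c, e)" "c \<in> topspace (simplex_top k)" "e \<in> topspace (power_top k E)"
    using assms by auto
  have w: "weights_pmf k c \<in> fin_measures k {1..k}"
    using set_weights_pmf[OF z(2)] card_mono[OF _ set_weights_pmf[OF z(2)]]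
    by (auto simp: fin_measures_def intro: finite_subset)
  show ?thesis
    unfolding z(1) comb_pmf_eq_map_pmf[OF z(2)]
    using z(3) by (intro fin_measures_map_pmf[OF w]) (auto simp: power_top_def PiE_def)
qed

lemma topspace_join_top: "topspace (join_top k E) = fin_measures k (topspace E)"
proof -
  let ?D = "prod_topology (simplex_top k) (power_top k E)"
  have "{z \<in> topspace ?D. comb_pmf k z \<in> fin_measures k (topspace E)} = topspace ?D"
    using comb_pmf_in_fin_measures by blast
  then have "openin (join_top k E) (fin_measures k (topspace E))"
    unfolding openin_join_top by (metis openin_topspace order_refl)
  then show ?thesis
    by (auto simp: topspace_def openin_join_top)
qed

text \<open>The square formed by \<open>id \<times> F\<^sup>k\<close>, the push-forward and the two quotient maps \<^const>\<open>comb_pmf\<close> commutes,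
  and the topologies are coinduced.\<close>

lemma continuous_map_join_pushforward:
  assumes F: "continuous_map E E' F"
  shows "continuous_map (join_top k E) (join_top k E') (map_pmf F)"
  unfolding continuous_map_def
proof (intro conjI allI impI)
  have FE: "F ` topspace E \<subseteq> topspace E'" using F by (auto simp: continuous_map_def)
  then show "map_pmf F \<in> topspace (join_top k E) \<rightarrow> topspace (join_top k E')"
    by (auto simp: topspace_join_top intro: fin_measures_map_pmf)
  fix V assume V: "openin (join_top k E') V"
  let ?D = "prod_topology (simplex_top k) (power_top k E)"
  let ?D' = "prod_topology (simplex_top k) (power_top k E')"
  have Fk: "continuous_map (power_top k E) (power_top k E') (power_map k F)"
    unfolding power_top_def continuous_map_componentwise
  proof (intro conjI ballI)
    fix i assume i: "i \<in> {1..k}"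
    have "continuous_map (product_topology (\<lambda>_. E) {1..k}) E (\<lambda>e. e i)"
      using i by (rule continuous_map_product_projection)
    then have "continuous_map (product_topology (\<lambda>_. E) {1..k}) E' (F \<circ> (\<lambda>e. e i))"
      using F by (rule continuous_map_compose)
    then show "continuous_map (product_topology (\<lambda>_. E) {1..k}) E' (\<lambda>e. power_map k F e i)"
      using i by (simp add: power_map_def o_def)
  qed (auto simp: power_map_def)
  have "continuous_map ?D ?D' (\<lambda>(c, e). (c, power_map k F e))"
    using Fk continuous_map_compose[OF continuous_map_snd Fk, of "simplex_top k"]
    by (simp add: case_prod_beta' continuous_map_paired continuous_map_fst o_def)
  then have "openin ?D {z \<in> topspace ?D. (\<lambda>(c, e). (c, power_map k F e)) z \<in>
      {z \<in> topspace ?D'. comb_pmf k z \<in> V}}"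
    using V by (intro openin_continuous_map_preimage) (auto simp: openin_join_top)
  also have "{z \<in> topspace ?D. (\<lambda>(c, e). (c, power_map k F e)) z \<in> {z \<in> topspace ?D'. comb_pmf k z \<in> V}}
      = {z \<in> topspace ?D. comb_pmf k z \<in> {\<mu> \<in> fin_measures k (topspace E). map_pmf F \<mu> \<in> V}}"
  proof -
    have "(\<lambda>(c, e). (c, power_map k F e)) z \<in> {z \<in> topspace ?D'. comb_pmf k z \<in> V} \<longleftrightarrow>
        comb_pmf k z \<in> {\<mu> \<in> fin_measures k (topspace E). map_pmf F \<mu> \<in> V}"
      if "z \<in> topspace ?D" for z
    proof -
      obtain c e where z: "z = (c, e)" "c \<in> topspace (simplex_top k)" "e \<in> topspace (power_top k E)"
        using \<open>z \<in> topspace ?D\<close> by auto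
      have "power_map k F e \<in> topspace (power_top k E')"
        using Fk z(3) by (auto simp: continuous_map_def)
      moreover have "comb_pmf k z \<in> fin_measures k (topspace E)"
        using comb_pmf_in_fin_measures[OF that] .
      ultimately show ?thesis using z by (auto simp: comb_pmf_power_map)
    qed
    then show ?thesis by blast
  qed
  finally show "openin (join_top k E) {\<mu> \<in> topspace (join_top k E). map_pmf F \<mu> \<in> V}"
    by (auto simp: openin_join_top topspace_join_top)
qed

section \<open>Push-forward in the Levy--Prokhorov topology\<close>

text \<open>Estimates are made with the individual \<open>\<epsilon>\<close> below rather than with their infimum \<^const>\<open>lp_dist\<close>, because an
  infimum over open thickenings need not be attained.\<close>

definition lp_close :: "'e metric \<Rightarrow> real \<Rightarrow> 'e pmf \<Rightarrow> 'e pmf \<Rightarrow> bool" where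
  "lp_close m \<epsilon> \<mu> \<nu> \<longleftrightarrow> \<epsilon> > 0 \<and>
     (\<forall>A \<in> sigma_sets (mspace m) {U. openin (mtopology_of m) U}.
        measure_pmf.prob \<mu> A \<le> measure_pmf.prob \<nu> (thickening m A \<epsilon>) + \<epsilon> \<and>
        measure_pmf.prob \<nu> A \<le> measure_pmf.prob \<mu> (thickening m A \<epsilon>) + \<epsilon>)"

lemma lp_dist_eq: "lp_dist m \<mu> \<nu> = Inf {\<epsilon>. lp_close m \<epsilon> \<mu> \<nu>}"
  by (simp add: lp_dist_def lp_close_def)

lemma lp_close_sym: "lp_close m \<epsilon> \<mu> \<nu> \<longleftrightarrow> lp_close m \<epsilon> \<nu> \<mu>"
  by (auto simp: lp_close_def)

lemma lp_close_one: "lp_close m 1 \<mu> \<nu>"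
  by (auto simp: lp_close_def add_increasing)

lemma bdd_below_lp_close: "bdd_below {\<epsilon>. lp_close m \<epsilon> \<mu> \<nu>}"
  by (rule bdd_belowI[of _ 0]) (auto simp: lp_close_def)

lemma lp_dist_less_iff: "lp_dist m \<mu> \<nu> < r \<longleftrightarrow> (\<exists>\<epsilon>. lp_close m \<epsilon> \<mu> \<nu> \<and> \<epsilon> < r)"
  using cInf_less_iff[OF _ bdd_below_lp_close, of m \<mu> \<nu> r] lp_close_one[of m \<mu> \<nu>]
  unfolding lp_dist_eq by auto

lemma lp_dist_le: "lp_close m \<epsilon> \<mu> \<nu> \<Longrightarrow> lp_dist m \<mu> \<nu> \<le> \<epsilon>"
  unfolding lp_dist_eq by (rule cInf_lower[OF _ bdd_below_lp_close]) simp

lemma lp_dist_nonneg: "0 \<le> lp_dist m \<mu> \<nu>"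
  unfolding lp_dist_eq
proof (rule cInf_greatest)
  show "{\<epsilon>. lp_close m \<epsilon> \<mu> \<nu>} \<noteq> {}" using lp_close_one by blast
qed (auto simp: lp_close_def)

lemma thickening_borel:
  assumes "A \<subseteq> mspace m"
  shows "thickening m A \<epsilon> \<in> sigma_sets (mspace m) {U. openin (mtopology_of m) U}"
proof -
  interpret Metric_space "mspace m" "mdist m" by (rule Metric_space_mspace_mdist)
  have "thickening m A \<epsilon> = (\<Union>a\<in>A. mball a \<epsilon>)"
    using assms by (auto simp: thickening_def mball_def)
  then show ?thesis
    by (auto simp: mtopology_of_def intro!: sigma_sets.Basic)
qed

lemma finite_borel:
  assumes "finite A" "A \<subseteq> mspace m"
  shows "A \<in> sigma_sets (mspace m) {U. openin (mtopology_of m) U}"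
proof -
  interpret Metric_space "mspace m" "mdist m" by (rule Metric_space_mspace_mdist)
  have "closedin (mtopology_of m) A"
    using assms unfolding mtopology_of_def
    by (intro t1_space_closedin_finite[THEN iffD1, rule_format])
      (auto intro: Hausdorff_imp_t1_space Hausdorff_space_mtopology)
  then have "openin (mtopology_of m) (mspace m - A)"
    by (simp add: closedin_def)
  then have "mspace m - (mspace m - A) \<in> sigma_sets (mspace m) {U. openin (mtopology_of m) U}"
    by (intro sigma_sets.Compl sigma_sets.Basic) simp
  then show ?thesis using assms by (simp add: double_diff)
qed

lemma borel_subset_mspace:
  assumes "A \<in> sigma_sets (mspace m) {U. openin (mtopology_of m) U}"
  shows "A \<subseteq> mspace m"
  using sigma_sets_into_sp[OF _ assms] openin_subset[of "mtopology_of m"] by auto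

text \<open>Thickenings of Borel sets are open, hence again Borel, so the two estimates can be chained.\<close>

lemma lp_close_trans:
  assumes 1: "lp_close m \<delta> \<mu> \<nu>" and 2: "lp_close m \<epsilon> \<nu> \<rho>"
  shows "lp_close m (\<delta> + \<epsilon>) \<mu> \<rho>"
proof -
  interpret Metric_space "mspace m" "mdist m" by (rule Metric_space_mspace_mdist)
  have half: "measure_pmf.prob \<mu> A \<le> measure_pmf.prob \<rho> (thickening m A (\<delta> + \<epsilon>)) + (\<delta> + \<epsilon>)"
    if 1: "lp_close m \<delta> \<mu> \<nu>" and 2: "lp_close m \<epsilon> \<nu> \<rho>"
      and A: "A \<in> sigma_sets (mspace m) {U. openin (mtopology_of m) U}" for \<mu> \<nu> \<rho> :: "'a pmf" and \<delta> \<epsilon> A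
  proof -
    note AM = borel_subset_mspace[OF A]
    have "measure_pmf.prob \<mu> A \<le> measure_pmf.prob \<nu> (thickening m A \<delta>) + \<delta>"
      using 1 A by (auto simp: lp_close_def)
    also have "measure_pmf.prob \<nu> (thickening m A \<delta>) \<le>
        measure_pmf.prob \<rho> (thickening m (thickening m A \<delta>) \<epsilon>) + \<epsilon>"
      using 2 thickening_borel[OF AM] by (auto simp: lp_close_def)
    also have "thickening m (thickening m A \<delta>) \<epsilon> \<subseteq> thickening m A (\<delta> + \<epsilon>)"
    proof
      fix x assume "x \<in> thickening m (thickening m A \<delta>) \<epsilon>"
      then obtain a y where *: "a \<in> A" "y \<in> mspace m" "x \<in> mspace m" "mdist m a y < \<delta>" "mdist m y x < \<epsilon>"
        by (auto simp: thickening_def)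
      then have "mdist m a x < \<delta> + \<epsilon>" using triangle[of a y x] AM by auto
      then show "x \<in> thickening m A (\<delta> + \<epsilon>)" using * by (auto simp: thickening_def)
    qed
    then have "measure_pmf.prob \<rho> (thickening m (thickening m A \<delta>) \<epsilon>) \<le>
        measure_pmf.prob \<rho> (thickening m A (\<delta> + \<epsilon>))"
      by (intro measure_pmf.finite_measure_mono) auto
    finally show ?thesis by simp
  qed
  show ?thesis
    unfolding lp_close_def
  proof (intro conjI ballI)
    show "0 < \<delta> + \<epsilon>" using 1 2 by (auto simp: lp_close_def)
  next
    fix A assume A: "A \<in> sigma_sets (mspace m) {U. openin (mtopology_of m) U}"
    show "measure_pmf.prob \<mu> A \<le> measure_pmf.prob \<rho> (thickening m A (\<delta> + \<epsilon>)) + (\<delta> + \<epsilon>)"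
      using half[OF 1 2 A] .
    show "measure_pmf.prob \<rho> A \<le> measure_pmf.prob \<mu> (thickening m A (\<delta> + \<epsilon>)) + (\<delta> + \<epsilon>)"
      using half[of \<epsilon> \<rho> \<nu> \<delta> \<mu> A] 1 2 A by (simp add: lp_close_sym add.commute)
  qed
qed

lemma lp_dist_self: "lp_dist m \<mu> \<mu> = 0" if \<mu>: "set_pmf \<mu> \<subseteq> mspace m"
proof -
  interpret Metric_space "mspace m" "mdist m" by (rule Metric_space_mspace_mdist)
  have "lp_close m \<epsilon> \<mu> \<mu>" if "\<epsilon> > 0" for \<epsilon>
  proof -
    have "measure_pmf.prob \<mu> A \<le> measure_pmf.prob \<mu> (thickening m A \<epsilon>)"
      if A: "A \<in> sigma_sets (mspace m) {U. openin (mtopology_of m) U}" for A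
      using borel_subset_mspace[OF A] \<open>\<epsilon> > 0\<close>
      by (intro measure_pmf.finite_measure_mono) (auto simp: thickening_def intro!: bexI)
    then show ?thesis using that by (fastforce simp: lp_close_def add_increasing2)
  qed
  then have "lp_dist m \<mu> \<mu> \<le> \<epsilon>" if "\<epsilon> > 0" for \<epsilon>
    using that lp_dist_le by blast
  then show ?thesis using lp_dist_nonneg[of m \<mu> \<mu>] by (meson dense_ge order.antisym)
qed

text \<open>A small thickening of \<open>{a}\<close> contains no atom of \<open>\<nu>\<close> other than \<open>a\<close>, as there are only finitely many.\<close>

lemma lp_dist_zero_imp_pmf_le:
  assumes \<mu>: "\<mu> \<in> fin_measures k (mspace m)" and \<nu>: "\<nu> \<in> fin_measures k (mspace m)"
    and 0: "lp_dist m \<mu> \<nu> = 0" and a: "a \<in> mspace m"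
  shows "pmf \<mu> a \<le> pmf \<nu> a"
proof (rule field_le_epsilon)
  interpret Metric_space "mspace m" "mdist m" by (rule Metric_space_mspace_mdist)
  fix \<epsilon> :: real assume "\<epsilon> > 0"
  have fin: "finite (mdist m a ` (set_pmf \<nu> - {a}))" using \<nu> by (auto simp: fin_measures_def)
  define r where "r = Min (insert \<epsilon> (mdist m a ` (set_pmf \<nu> - {a})))"
  have "0 < mdist m a x" if "x \<in> set_pmf \<nu>" "x \<noteq> a" for x
    using that \<nu> a nonneg[of a x] zero[of a x] by (auto simp: fin_measures_def simp del: nonneg)
  then have "r > 0"
    unfolding r_def using fin \<open>\<epsilon> > 0\<close> by (subst Min_gr_iff) auto
  then have r: "r > 0" "r \<le> \<epsilon>" "\<And>x. x \<in> set_pmf \<nu> \<Longrightarrow> x \<noteq> a \<Longrightarrow> r \<le> mdist m a x"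
    using fin by (auto simp: r_def intro!: Min_le)
  obtain \<delta> where \<delta>: "lp_close m \<delta> \<mu> \<nu>" "\<delta> < r"
    using lp_dist_less_iff[of m \<mu> \<nu> r] 0 r(1) by auto
  have "pmf \<mu> a = measure_pmf.prob \<mu> {a}" by (simp add: measure_pmf_single)
  also have "\<dots> \<le> measure_pmf.prob \<nu> (thickening m {a} \<delta>) + \<delta>"
    using \<delta> a finite_borel[of "{a}" m] by (auto simp: lp_close_def)
  also have "measure_pmf.prob \<nu> (thickening m {a} \<delta>) = measure_pmf.prob \<nu> (thickening m {a} \<delta> \<inter> set_pmf \<nu>)"
    by (simp add: measure_Int_set_pmf)
  also have "\<dots> \<le> measure_pmf.prob \<nu> {a}"
    using r(3) \<delta>(2) by (intro measure_pmf.finite_measure_mono) (fastforce simp: thickening_def)+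
  also have "\<dots> = pmf \<nu> a" by (simp add: measure_pmf_single)
  finally show "pmf \<mu> a \<le> pmf \<nu> a + \<epsilon>" using \<delta> r by simp
qed

lemma Metric_space_lp_dist: "Metric_space (fin_measures k (mspace m)) (lp_dist m)"
proof
  show "0 \<le> lp_dist m \<mu> \<nu>" for \<mu> \<nu> by (rule lp_dist_nonneg)
  show comm: "lp_dist m \<mu> \<nu> = lp_dist m \<nu> \<mu>" for \<mu> \<nu>
    by (simp add: lp_dist_eq lp_close_sym)
  show "lp_dist m \<mu> \<nu> = 0 \<longleftrightarrow> \<mu> = \<nu>"
    if "\<mu> \<in> fin_measures k (mspace m)" "\<nu> \<in> fin_measures k (mspace m)" for \<mu> \<nu>
  proof
    assume 0: "lp_dist m \<mu> \<nu> = 0"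
    show "\<mu> = \<nu>"
    proof (rule pmf_eqI)
      fix a
      show "pmf \<mu> a = pmf \<nu> a"
      proof (cases "a \<in> mspace m")
        case True
        then show ?thesis
          using lp_dist_zero_imp_pmf_le[of \<mu> k m \<nu> a] lp_dist_zero_imp_pmf_le[of \<nu> k m \<mu> a] 0 that comm[of \<mu> \<nu>]
          by simp
      next
        case False
        then have "a \<notin> set_pmf \<mu>" "a \<notin> set_pmf \<nu>" using that by (auto simp: fin_measures_def)
        then show ?thesis by (simp add: set_pmf_iff)
      qed
    qed
  qed (use that in \<open>auto simp: fin_measures_def lp_dist_self\<close>)
  show "lp_dist m \<mu> \<rho> \<le> lp_dist m \<mu> \<nu> + lp_dist m \<nu> \<rho>" for \<mu> \<nu> \<rho>
  proof (rule field_le_epsilon)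
    fix e :: real assume "e > 0"
    obtain \<delta> where \<delta>: "lp_close m \<delta> \<mu> \<nu>" "\<delta> < lp_dist m \<mu> \<nu> + e / 2"
      using lp_dist_less_iff[of m \<mu> \<nu> "lp_dist m \<mu> \<nu> + e / 2"] \<open>e > 0\<close> by auto
    obtain \<epsilon> where \<epsilon>: "lp_close m \<epsilon> \<nu> \<rho>" "\<epsilon> < lp_dist m \<nu> \<rho> + e / 2"
      using lp_dist_less_iff[of m \<nu> \<rho> "lp_dist m \<nu> \<rho> + e / 2"] \<open>e > 0\<close> by auto
    show "lp_dist m \<mu> \<rho> \<le> lp_dist m \<mu> \<nu> + lp_dist m \<nu> \<rho> + e"
      using lp_dist_le[OF lp_close_trans[OF \<delta>(1) \<epsilon>(1)]] \<delta>(2) \<epsilon>(2) by linarith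
  qed
qed

lemma continuous_map_uniform_radius:
  assumes F: "continuous_map (mtopology_of m) (mtopology_of m') F"
    and S: "finite S" "S \<subseteq> mspace m" and \<epsilon>: "\<epsilon> > 0"
  obtains r where "r > 0" "\<And>a x. a \<in> S \<Longrightarrow> x \<in> mspace m \<Longrightarrow> mdist m a x < r \<Longrightarrow> mdist m' (F a) (F x) < \<epsilon>"
proof -
  interpret M: Metric_space "mspace m" "mdist m" by (rule Metric_space_mspace_mdist)
  have "\<exists>r>0. \<forall>x\<in>mspace m. mdist m a x < r \<longrightarrow> mdist m' (F a) (F x) < \<epsilon>" if "a \<in> S" for a
    using F S(2) \<epsilon> that unfolding mtopology_of_def M.metric_continuous_map[OF Metric_space_mspace_mdist]
    by (metis subsetD)
  then obtain r where r: "\<And>a. a \<in> S \<Longrightarrow> r a > 0"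
    "\<And>a x. a \<in> S \<Longrightarrow> x \<in> mspace m \<Longrightarrow> mdist m a x < r a \<Longrightarrow> mdist m' (F a) (F x) < \<epsilon>"
    by metis
  show thesis
  proof (rule that[of "Min (insert 1 (r ` S))"])
    show "Min (insert 1 (r ` S)) > 0" using r(1) S(1) by (auto simp: Min_gr_iff)
    fix a x assume "a \<in> S" "x \<in> mspace m" "mdist m a x < Min (insert 1 (r ` S))"
    then show "mdist m' (F a) (F x) < \<epsilon>" using r(2)[of a x] S(1) by (auto simp: Min_gr_iff)
  qed
qed

text \<open>Only the \<open>\<delta>\<close>-neighbourhoods of the atoms of \<open>\<mu>\<close> are ever used, so \<open>F\<close> has to be controlled at these finitely
  many points alone.\<close>

lemma lp_close_pushforward:
  assumes F: "F \<in> mspace m \<rightarrow> mspace m'"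
    and \<mu>: "set_pmf \<mu> \<subseteq> mspace m" "finite (set_pmf \<mu>)"
    and close: "lp_close m \<delta> \<mu> \<nu>" and le: "\<delta> \<le> \<epsilon>"
    and near: "\<And>a x. a \<in> set_pmf \<mu> \<Longrightarrow> x \<in> mspace m \<Longrightarrow> mdist m a x < \<delta> \<Longrightarrow> mdist m' (F a) (F x) < \<epsilon>"
  shows "lp_close m' \<epsilon> (map_pmf F \<mu>) (map_pmf F \<nu>)"
  unfolding lp_close_def
proof (intro conjI ballI)
  interpret M': Metric_space "mspace m'" "mdist m'" by (rule Metric_space_mspace_mdist)
  show "\<epsilon> > 0" using close le by (auto simp: lp_close_def)
  fix A assume A: "A \<in> sigma_sets (mspace m') {U. openin (mtopology_of m') U}"
  let ?A\<epsilon> = "thickening m' A \<epsilon>"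
  have small: "measure_pmf.prob \<mu> S \<le> measure_pmf.prob \<nu> (thickening m S \<delta>) + \<epsilon>" if "S \<subseteq> set_pmf \<mu>" for S
  proof -
    have "S \<in> sigma_sets (mspace m) {U. openin (mtopology_of m) U}"
      using that \<mu> by (intro finite_borel) (auto intro: finite_subset)
    then show ?thesis using close le by (fastforce simp: lp_close_def)
  qed
  show "measure_pmf.prob (map_pmf F \<mu>) A \<le> measure_pmf.prob (map_pmf F \<nu>) ?A\<epsilon> + \<epsilon>"
  proof -
    \<comment> \<open>The mass of \<open>\<mu>\<close> over \<open>A\<close> sits on atoms, whose neighbourhoods \<open>F\<close> sends into the thickening of \<open>A\<close>.\<close>
    let ?S = "F -` A \<inter> set_pmf \<mu>"
    have "measure_pmf.prob (map_pmf F \<mu>) A = measure_pmf.prob \<mu> ?S"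
      by (simp add: measure_Int_set_pmf)
    also have "\<dots> \<le> measure_pmf.prob \<nu> (thickening m ?S \<delta>) + \<epsilon>" by (rule small) simp
    also have "thickening m ?S \<delta> \<subseteq> F -` ?A\<epsilon>"
      using near F by (fastforce simp: thickening_def)
    then have "measure_pmf.prob \<nu> (thickening m ?S \<delta>) \<le> measure_pmf.prob \<nu> (F -` ?A\<epsilon>)"
      by (intro measure_pmf.finite_measure_mono) auto
    finally show ?thesis by simp
  qed
  show "measure_pmf.prob (map_pmf F \<nu>) A \<le> measure_pmf.prob (map_pmf F \<mu>) ?A\<epsilon> + \<epsilon>"
  proof -
    \<comment> \<open>Here \<open>\<nu>\<close> is compared with \<open>\<mu>\<close> through complements: \<open>F\<close> sends no point near an atom in \<open>?T\<close> into \<open>A\<close>.\<close>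
    let ?T = "set_pmf \<mu> - F -` ?A\<epsilon>"
    have "thickening m ?T \<delta> \<inter> F -` A = {}"
    proof -
      have "F a \<in> ?A\<epsilon>" if *: "a \<in> set_pmf \<mu>" "x \<in> mspace m" "mdist m a x < \<delta>" "F x \<in> A" for a x
        using near[OF *(1-3)] F \<mu> * M'.commute[of "F a" "F x"] by (auto simp: thickening_def)
      then show ?thesis by (fastforce simp: thickening_def)
    qed
    then have "F -` A \<subseteq> - thickening m ?T \<delta>" by auto
    then have "measure_pmf.prob \<nu> (F -` A) \<le> measure_pmf.prob \<nu> (- thickening m ?T \<delta>)"
      by (intro measure_pmf.finite_measure_mono) auto
    also have "\<dots> = 1 - measure_pmf.prob \<nu> (thickening m ?T \<delta>)"
      using measure_pmf.prob_compl[of "thickening m ?T \<delta>" \<nu>] by (simp add: Compl_eq_Diff_UNIV)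
    also have "\<dots> \<le> 1 - measure_pmf.prob \<mu> ?T + \<epsilon>" using small[of ?T] by simp
    also have "measure_pmf.prob \<mu> ?T = measure_pmf.prob \<mu> (- (F -` ?A\<epsilon>))"
      by (subst (2) measure_Int_set_pmf[symmetric]) (simp add: Diff_eq Int_commute)
    also have "1 - \<dots> = measure_pmf.prob \<mu> (F -` ?A\<epsilon>)"
      using measure_pmf.prob_compl[of "F -` ?A\<epsilon>" \<mu>] by (simp add: Compl_eq_Diff_UNIV)
    finally show ?thesis by simp
  qed
qed

lemma metrizable_space_SOME_metric:
  assumes "metrizable_space E"
  shows "mtopology_of (SOME m. mtopology_of m = E) = E"
proof (rule someI_ex)
  obtain M d where "Metric_space M d" "E = Metric_space.mtopology M d"
    using assms by (auto simp: metrizable_space_def)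
  then show "\<exists>m. mtopology_of m = E"
    using Metric_space.mtopology_of[of M d] by metis
qed

lemma continuous_map_lp_pushforward:
  assumes F: "continuous_map E E' F" and E: "metrizable_space E" and E': "metrizable_space E'"
  shows "continuous_map (lp_top k E) (lp_top k E') (map_pmf F)"
proof -
  define m where "m = (SOME m. mtopology_of m = E)"
  define m' where "m' = (SOME m. mtopology_of m = E')"
  have m: "mtopology_of m = E" and m': "mtopology_of m' = E'"
    using E E' by (auto simp: m_def m'_def intro: metrizable_space_SOME_metric)
  have ts: "topspace E = mspace m" "topspace E' = mspace m'" by (simp_all flip: m m')
  interpret L: Metric_space "fin_measures k (mspace m)" "lp_dist m" by (rule Metric_space_lp_dist)
  interpret L': Metric_space "fin_measures k (mspace m')" "lp_dist m'" by (rule Metric_space_lp_dist)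
  have FE: "F \<in> mspace m \<rightarrow> mspace m'" using F by (auto simp: continuous_map_def ts)
  have "continuous_map L.mtopology L'.mtopology (map_pmf F)"
    unfolding L'.continuous_map_to_metric
  proof (intro ballI allI impI)
    fix \<mu> and \<epsilon> :: real assume \<mu>: "\<mu> \<in> topspace L.mtopology" and \<epsilon>: "\<epsilon> > 0"
    then have \<mu>': "\<mu> \<in> fin_measures k (mspace m)" by simp
    then have fin: "finite (set_pmf \<mu>)" "set_pmf \<mu> \<subseteq> mspace m" by (auto simp: fin_measures_def)
    obtain r where r: "r > 0"
      "\<And>a x. a \<in> set_pmf \<mu> \<Longrightarrow> x \<in> mspace m \<Longrightarrow> mdist m a x < r \<Longrightarrow> mdist m' (F a) (F x) < \<epsilon> / 2"
      using continuous_map_uniform_radius[of m m' F "set_pmf \<mu>" "\<epsilon> / 2"] F fin \<epsilon> by (auto simp: m m')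
    have "map_pmf F \<nu> \<in> L'.mball (map_pmf F \<mu>) \<epsilon>" if \<nu>: "\<nu> \<in> L.mball \<mu> (min r (\<epsilon> / 2))" for \<nu>
    proof -
      have \<nu>': "\<nu> \<in> fin_measures k (mspace m)" using \<nu> by simp
      obtain \<delta> where \<delta>: "lp_close m \<delta> \<mu> \<nu>" "\<delta> < min r (\<epsilon> / 2)"
      proof -
        have "lp_dist m \<mu> \<nu> < min r (\<epsilon> / 2)" using \<nu> by simp
        then show thesis using that lp_dist_less_iff by blast
      qed
      have "lp_close m' (\<epsilon> / 2) (map_pmf F \<mu>) (map_pmf F \<nu>)"
        using FE fin(2,1) \<delta>(1)
      proof (rule lp_close_pushforward)
        show "\<delta> \<le> \<epsilon> / 2" using \<delta>(2) by simp
        show "mdist m' (F a) (F x) < \<epsilon> / 2"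
          if "a \<in> set_pmf \<mu>" "x \<in> mspace m" "mdist m a x < \<delta>" for a x
          using r(2)[of a x] that \<delta>(2) by simp
      qed
      then have "lp_dist m' (map_pmf F \<mu>) (map_pmf F \<nu>) < \<epsilon>"
        using lp_dist_le \<epsilon> by fastforce
      moreover have "map_pmf F \<mu> \<in> fin_measures k (mspace m')" "map_pmf F \<nu> \<in> fin_measures k (mspace m')"
        using FE \<mu>' \<nu>' by (auto intro: fin_measures_map_pmf)
      ultimately show ?thesis by simp
    qed
    then show "\<exists>U. openin L.mtopology U \<and> \<mu> \<in> U \<and> (\<forall>\<nu>\<in>U. map_pmf F \<nu> \<in> L'.mball (map_pmf F \<mu>) \<epsilon>)"
      using r(1) \<epsilon> \<mu>' by (intro exI[of _ "L.mball \<mu> (min r (\<epsilon> / 2))"]) auto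
  qed
  then show ?thesis by (simp add: lp_top_def ts flip: m_def m'_def)
qed

section \<open>Fibrewise maps and sectional invariants\<close>

lemma continuous_map_pushforward:
  assumes "continuous_map E E' F" "admissible \<tau> E" "admissible \<tau> E'"
  shows "continuous_map (measure_top \<tau> k E) (measure_top \<tau> k E') (map_pmf F)"
  using assms continuous_map_lp_pushforward continuous_map_join_pushforward
  by (cases \<tau>) (auto simp: admissible_def)

text \<open>Sections compose with maps over the base.\<close>

lemma secat_fibrewise_mono:
  assumes F: "continuous_map E E' F" and p: "\<And>e. e \<in> topspace E \<Longrightarrow> p' (F e) = p e"
  shows "secat E' B p' \<le> secat E B p"
  unfolding secat_def
proof (rule Inf_superset_mono, safe)
  fix n and U :: "nat \<Rightarrow> 'c set"
  assume U: "(\<Union>i\<in>{0..n}. U i) = topspace B"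
    and s: "\<forall>i\<in>{0..n}. openin B (U i) \<and>
      (\<exists>s. continuous_map (subtopology B (U i)) E s \<and> (\<forall>b\<in>U i. p (s b) = b))"
  have sec: "\<exists>s. continuous_map (subtopology B (U i)) E' s \<and> (\<forall>b\<in>U i. p' (s b) = b)"
    if i: "i \<in> {0..n}" for i
  proof -
    obtain s where s: "continuous_map (subtopology B (U i)) E s" "\<forall>b\<in>U i. p (s b) = b"
      using s i by blast
    have "p' ((F \<circ> s) b) = b" if b: "b \<in> U i" for b
    proof -
      have "b \<in> topspace (subtopology B (U i))" using b i unfolding topspace_subtopology U[symmetric] by blast
      then have "s b \<in> topspace E" using s(1) by (auto simp: continuous_map_def)
      then show ?thesis using p s(2) b by simp
    qed
    then show ?thesis using continuous_map_compose[OF s(1) F] by blast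
  qed
  have "\<forall>i\<in>{0..n}. openin B (U i) \<and> (\<exists>s. continuous_map (subtopology B (U i)) E' s \<and> (\<forall>b\<in>U i. p' (s b) = b))"
    using s sec by blast
  with U show "\<exists>n'. enat n = enat n' \<and> (\<exists>U. (\<Union>i\<in>{0..n'}. U i) = topspace B \<and> (\<forall>i\<in>{0..n'}. openin B (U i) \<and>
      (\<exists>s. continuous_map (subtopology B (U i)) E' s \<and> (\<forall>b\<in>U i. p' (s b) = b))))"
    by blast
qed

lemma fibre_proj_eq: "(\<And>e. e \<in> set_pmf \<mu> \<Longrightarrow> p e = b) \<Longrightarrow> fibre_proj p \<mu> = b"
  unfolding fibre_proj_def using set_pmf_not_empty[of \<mu>] by (intro the_equality) auto

text \<open>A map over the base sends measures on a fibre to measures on the fibre over the same point, without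
  increasing the size of the support.\<close>

lemma dsecat_fibrewise_mono:
  assumes F: "continuous_map E E' F" and p: "\<And>e. e \<in> topspace E \<Longrightarrow> p' (F e) = p e"
    and adm: "admissible \<tau> E" "admissible \<tau> E'"
  shows "dsecat \<tau> E' B p' \<le> dsecat \<tau> E B p"
  unfolding dsecat_def
proof (rule Inf_superset_mono, safe)
  fix n s
  assume s: "continuous_map B (fibre_measures \<tau> (n + 1) E B p) s" "\<forall>b\<in>topspace B. fibre_proj p (s b) = b"
  let ?G = "\<lambda>E p. {\<mu> \<in> fin_measures (n + 1) (topspace E). \<exists>b\<in>topspace B. \<forall>e\<in>set_pmf \<mu>. p e = b}"
  have FE: "F ` topspace E \<subseteq> topspace E'" using F by (auto simp: continuous_map_def)
  have push: "map_pmf F \<mu> \<in> ?G E' p'" "fibre_proj p' (map_pmf F \<mu>) = fibre_proj p \<mu>" if \<mu>: "\<mu> \<in> ?G E p" for \<mu>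
  proof -
    obtain b where b: "b \<in> topspace B" "\<And>e. e \<in> set_pmf \<mu> \<Longrightarrow> p e = b"
      using \<mu> by auto
    have "p' (F e) = b" if "e \<in> set_pmf \<mu>" for e
      using b p[of e] that \<mu> by (auto simp: fin_measures_def)
    then have b': "p' e = b" if "e \<in> set_pmf (map_pmf F \<mu>)" for e using that by auto
    show "map_pmf F \<mu> \<in> ?G E' p'" using \<mu> b(1) b' FE by (auto intro!: fin_measures_map_pmf)
    show "fibre_proj p' (map_pmf F \<mu>) = fibre_proj p \<mu>"
      using fibre_proj_eq[of \<mu> p b] fibre_proj_eq[of "map_pmf F \<mu>" p' b] b b' by simp
  qed
  have "continuous_map (fibre_measures \<tau> (n + 1) E B p) (fibre_measures \<tau> (n + 1) E' B p') (map_pmf F)"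
    unfolding fibre_measures_def
  proof (rule continuous_map_into_subtopology)
    show "continuous_map (subtopology (measure_top \<tau> (n + 1) E) (?G E p)) (measure_top \<tau> (n + 1) E') (map_pmf F)"
      using F adm by (intro continuous_map_from_subtopology continuous_map_pushforward)
    show "map_pmf F \<in> topspace (subtopology (measure_top \<tau> (n + 1) E) (?G E p)) \<rightarrow> ?G E' p'"
      using push(1) by auto
  qed
  with s(1) have "continuous_map B (fibre_measures \<tau> (n + 1) E' B p') (map_pmf F \<circ> s)"
    by (rule continuous_map_compose)
  moreover have "fibre_proj p' ((map_pmf F \<circ> s) b) = b" if "b \<in> topspace B" for b
  proof -
    have "s b \<in> ?G E p" using s(1) that by (auto simp: continuous_map_def fibre_measures_def)
    then show ?thesis using push(2) s(2) that by simp
  qed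
  ultimately show "\<exists>n'. enat n = enat n' \<and> (\<exists>s. continuous_map B (fibre_measures \<tau> (n' + 1) E' B p') s \<and>
      (\<forall>b\<in>topspace B. fibre_proj p' (s b) = b))"
    by blast
qed

section \<open>The subdivided unit interval\<close>

locale unit_partition =
  fixes m :: nat and t :: "nat \<Rightarrow> real"
  assumes two_le: "m \<ge> 2" and t_first: "t 1 = 0" and t_last: "t m = 1"
    and t_strict: "strict_mono_on {1..m} t"
begin

lemma t_less: "i \<in> {1..m} \<Longrightarrow> j \<in> {1..m} \<Longrightarrow> i < j \<Longrightarrow> t i < t j"
  using t_strict by (auto simp: strict_mono_on_def)

lemma t_le_iff: "i \<in> {1..m} \<Longrightarrow> j \<in> {1..m} \<Longrightarrow> t i \<le> t j \<longleftrightarrow> i \<le> j"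
  using t_less[of i j] t_less[of j i] by (cases i j rule: linorder_cases) auto

lemma t_unit: "i \<in> {1..m} \<Longrightarrow> 0 \<le> t i \<and> t i \<le> 1"
  using t_le_iff[of 1 i] t_le_iff[of i m] two_le t_first t_last by auto

text \<open>All time changes below are obtained by prescribing their values at the points \<open>t\<^sub>i\<close>:
  which points the resulting paths pass through at the times \<open>t\<^sub>i\<close> depends on these values only.\<close>

lemma interpolate_on_subdivision:
  assumes a: "\<And>i. i \<in> {1..m} \<Longrightarrow> 0 \<le> a i \<and> a i \<le> (1::real)"
  obtains \<phi> where "continuous_map (top_of_set {0..1::real}) (top_of_set {0..1}) \<phi>"
    and "\<And>i. i \<in> {1..m} \<Longrightarrow> \<phi> (t i) = a i"
proof -
  have inj: "inj_on t {1..m}"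
    using t_strict by (rule strict_mono_on_imp_inj_on)
  have inv: "inv_into {1..m} t (t i) = i" if "i \<in> {1..m}" for i
    using inj that by (rule inv_into_f_f)
  let ?a = "a \<circ> inv_into {1..m} t"
  have 1: "continuous_on (t ` {1..m}) ?a"
    by (intro continuous_on_finite) auto
  have 2: "closedin (top_of_set {0..1}) (t ` {1..m})"
    using t_unit by (intro closed_subset finite_imp_closed) auto
  have 3: "?a x \<in> cbox 0 1" if "x \<in> t ` {1..m}" for x
    using that inv a by auto
  obtain \<phi> where "continuous_on {0..1} \<phi>" "\<And>x. x \<in> t ` {1..m} \<Longrightarrow> \<phi> x = ?a x"
    "\<And>x. x \<in> {0..1} \<Longrightarrow> \<phi> x \<in> cbox 0 1"
    using Tietze_closed_interval_1[OF 1 2 zero_le_one 3] by metis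
  then show thesis
    using inv by (intro that[of \<phi>]) (auto simp: continuous_map_in_subtopology)
qed

text \<open>Concatenation of paths depending on a parameter \<open>v\<close>. The pieces \<open>h\<^sub>j\<close> live on the whole unit interval;
  their restrictions to \<open>[t\<^sub>j, t\<^sub>j\<^sub>+\<^sub>1]\<close> are what is joined.\<close>

lemma glue_along_subdivision:
  assumes h: "\<And>j. j \<in> {1..<m} \<Longrightarrow> continuous_map (prod_topology (top_of_set {0..1}) V) Z (h j)"
    and match: "\<And>j v. 1 \<le> j \<Longrightarrow> Suc j < m \<Longrightarrow> v \<in> topspace V \<Longrightarrow>
      h j (t (Suc j), v) = h (Suc j) (t (Suc j), v)"
  shows "\<exists>H. continuous_map (prod_topology (top_of_set {0..1}) V) Z H \<and>
    (\<forall>j\<in>{1..<m}. \<forall>s\<in>{t j..t (Suc j)}. \<forall>v\<in>topspace V. H (s, v) = h j (s, v))"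
proof -
  let ?D = "prod_topology (top_of_set {0..1::real}) V"
  let ?T = "\<lambda>j. {t j..t (Suc j)} \<times> topspace V"
  have unit: "0 \<le> t j" "t (Suc j) \<le> 1" if "j \<in> {1..<m}" for j
    using t_unit[of j] t_unit[of "Suc j"] that by auto
  have cover: "topspace ?D \<subseteq> \<Union>(?T ` {1..<m})"
  proof clarsimp
    fix s :: real and v assume s: "0 \<le> s" "s \<le> 1"
    \<comment> \<open>The last subdivision point to the left of \<open>s\<close> starts an interval containing \<open>s\<close>.\<close>
    define J where "J = {i \<in> {1..<m}. t i \<le> s}"
    have "1 \<in> J" using two_le t_first s(1) by (simp add: J_def)
    then have J: "finite J" "J \<noteq> {}" by (auto simp: J_def)
    define j where "j = Max J"
    have jJ: "j \<in> J" using J by (simp add: j_def)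
    have "s \<le> t (Suc j)"
    proof (cases "Suc j < m")
      case True
      then have "Suc j \<notin> J" using J(1) by (metis Max_ge Suc_n_not_le_n j_def)
      then show ?thesis using True by (auto simp: J_def)
    next
      case False
      then have "Suc j = m" using jJ by (auto simp: J_def)
      then show ?thesis using t_last s by simp
    qed
    then show "\<exists>j\<in>{Suc 0..<m}. t j \<le> s \<and> s \<le> t (Suc j)"
      using jJ by (auto simp: J_def)
  qed
  have clo: "closedin ?D (?T j)" if "j \<in> {1..<m}" for j
    using unit[OF that]
    by (auto simp: closedin_prod_Times_iff intro!: closed_subset)
  have overlap: "h i z = h j z" if ij: "i < j" "i \<in> {1..<m}" "j \<in> {1..<m}" and zij: "z \<in> ?T i \<inter> ?T j" for i j z
  proof -
    obtain s v where z: "z = (s, v)" "v \<in> topspace V" "t j \<le> s" "s \<le> t (Suc i)"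
      using zij by auto
    then have "j \<le> Suc i" using t_le_iff[of j "Suc i"] ij by auto
    then have "j = Suc i" using ij by auto
    moreover from this have "s = t (Suc i)" using z by auto
    ultimately show ?thesis using match[of i v] ij(2,3) z(1,2) by simp
  qed
  have agree: "h i z = h j z" if "i \<in> {1..<m}" "j \<in> {1..<m}" "z \<in> topspace ?D \<inter> ?T i \<inter> ?T j" for i j z
  proof (cases i j rule: linorder_cases)
    case less
    then show ?thesis using that by (intro overlap) auto
  next
    case greater
    then show ?thesis using that by (intro overlap[symmetric]) auto
  qed simp
  have restr: "continuous_map (subtopology ?D (?T j)) Z (h j)" if "j \<in> {1..<m}" for j
    using h[OF that] by (rule continuous_map_from_subtopology)
  obtain H where H: "continuous_map ?D Z H"
    "\<And>x j. j \<in> {1..<m} \<Longrightarrow> x \<in> topspace ?D \<inter> ?T j \<Longrightarrow> H x = h j x"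
    using pasting_lemma_exists_closed[OF finite_atLeastLessThan cover clo restr agree] by blast
  have "H (s, v) = h j (s, v)" if "j \<in> {1..<m}" "s \<in> {t j..t (Suc j)}" "v \<in> topspace V" for j s v
    using that unit[OF that(1)] by (intro H(2)) auto
  with H(1) show ?thesis by blast
qed

section \<open>Homotopic distance as a sectional category\<close>

text \<open>A section over \<open>U\<close> amounts to a homotopy \<open>U \<times> I \<rightarrow> Z\<close> that is \<open>g\<^sub>i\<close> at time \<open>t\<^sub>i\<close>. Running it from \<open>t\<^sub>i\<close> to \<open>t\<^sub>j\<close>
  shows \<open>g\<^sub>i \<simeq> g\<^sub>j\<close>; conversely it is put together from homotopies \<open>g\<^sub>j \<simeq> g\<^sub>j\<^sub>+\<^sub>1\<close>.\<close>

lemma section_of_dist_total_iff: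
  assumes U: "U \<subseteq> topspace W"
  shows "(\<exists>s. continuous_map (subtopology W U) (dist_total t m W Z g) s \<and> (\<forall>w\<in>U. fst (s w) = w)) \<longleftrightarrow>
    (\<forall>i\<in>{1..m}. \<forall>j\<in>{1..m}. homotopic_with (\<lambda>_. True) (subtopology W U) Z (g i) (g j))"
    (is "?sec \<longleftrightarrow> ?hom")
proof
  let ?I = "top_of_set {0..1::real}"
  assume ?sec
  then obtain s where s: "continuous_map (subtopology W U) (dist_total t m W Z g) s"
    and fst: "\<And>w. w \<in> U \<Longrightarrow> fst (s w) = w" by blast
  have val: "snd (s w) (t i) = g i w" if "w \<in> U" "i \<in> {1..m}" for w i
  proof -
    have "s w \<in> topspace (dist_total t m W Z g)"
      using s that(1) U by (auto simp: continuous_map_def)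
    then show ?thesis using that fst[of w] by (auto simp: topspace_dist_total)
  qed
  show ?hom
  proof (intro ballI)
    fix i j assume ij: "i \<in> {1..m}" "j \<in> {1..m}"
    let ?D = "prod_topology ?I (subtopology W U)"
    have "continuous_map (subtopology W U) (path_space Z) (snd \<circ> s)"
      using s continuous_map_pullback_snd unfolding dist_total_def by (rule continuous_map_compose)
    then have "continuous_map ?D (path_space Z) ((snd \<circ> s) \<circ> snd)"
      by (rule continuous_map_compose[OF continuous_map_snd])
    moreover have "continuous_map ?D ?I (\<lambda>z. (1 - fst z) * t i + fst z * t j)"
    proof -
      have "continuous_map ?I ?I (\<lambda>r. (1 - r) * t i + r * t j)"
        using t_unit[OF ij(1)] t_unit[OF ij(2)]
        by (auto simp: continuous_map_in_subtopology intro!: continuous_intros convex_bound_le)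
      then have "continuous_map ?D ?I ((\<lambda>r. (1 - r) * t i + r * t j) \<circ> fst)"
        by (rule continuous_map_compose[OF continuous_map_fst])
      then show ?thesis by (simp add: o_def)
    qed
    ultimately have "continuous_map ?D Z (\<lambda>z. ((snd \<circ> s) \<circ> snd) z ((1 - fst z) * t i + fst z * t j))"
      by (rule continuous_map_path_eval)
    then show "homotopic_with (\<lambda>_. True) (subtopology W U) Z (g i) (g j)"
      using val ij U by (subst homotopic_with) (auto intro!: exI)
  qed
next
  let ?I = "top_of_set {0..1::real}"
  let ?V = "subtopology W U"
  assume hom: ?hom
  have "\<exists>h. continuous_map (prod_topology ?I ?V) Z h \<and>
      (\<forall>w\<in>U. h (0, w) = g j w \<and> h (1, w) = g (Suc j) w)" if "j \<in> {1..<m}" for j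
  proof -
    have "homotopic_with (\<lambda>_. True) ?V Z (g j) (g (Suc j))"
      using hom that by auto
    then show ?thesis
      using U by - (subst (asm) homotopic_with, auto)
  qed
  then obtain k where k: "\<And>j. j \<in> {1..<m} \<Longrightarrow> continuous_map (prod_topology ?I ?V) Z (k j)"
    "\<And>j w. j \<in> {1..<m} \<Longrightarrow> w \<in> U \<Longrightarrow> k j (0, w) = g j w \<and> k j (1, w) = g (Suc j) w"
    by metis
  \<comment> \<open>Time changes that spread the \<open>j\<close>-th homotopy over \<open>[t\<^sub>j, t\<^sub>j\<^sub>+\<^sub>1]\<close>.\<close>
  have "\<exists>\<rho>. continuous_map ?I ?I \<rho> \<and> (\<forall>i\<in>{1..m}. \<rho> (t i) = (if i \<le> j then 0 else 1))" for j
    using interpolate_on_subdivision[of "\<lambda>i. if i \<le> j then 0 else 1"] by (metis order.refl zero_le_one)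
  then obtain \<rho> where \<rho>: "\<And>j. continuous_map ?I ?I (\<rho> j)"
    "\<And>i j. i \<in> {1..m} \<Longrightarrow> \<rho> j (t i) = (if i \<le> j then 0 else 1)"
    by metis
  define h where "h j = k j \<circ> (\<lambda>z. (\<rho> j (fst z), snd z))" for j
  have h: "continuous_map (prod_topology ?I ?V) Z (h j)" if "j \<in> {1..<m}" for j
    unfolding h_def
  proof (rule continuous_map_compose[OF _ k(1)[OF that]])
    have "continuous_map (prod_topology ?I ?V) ?I (\<rho> j \<circ> fst)"
      using \<rho>(1) by (rule continuous_map_compose[OF continuous_map_fst])
    then show "continuous_map (prod_topology ?I ?V) (prod_topology ?I ?V) (\<lambda>z. (\<rho> j (fst z), snd z))"
      by (simp add: continuous_map_paired continuous_map_snd o_def)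
  qed
  have h_left: "h j (t j, w) = g j w" and h_right: "h j (t (Suc j), w) = g (Suc j) w"
    if "j \<in> {1..<m}" "w \<in> U" for j w
    using k(2)[OF that] \<rho>(2)[of j j] \<rho>(2)[of "Suc j" j] that by (auto simp: h_def)
  have match: "h j (t (Suc j), w) = h (Suc j) (t (Suc j), w)"
    if "1 \<le> j" "Suc j < m" "w \<in> topspace ?V" for j w
    using h_left[of "Suc j" w] h_right[of j w] that by auto
  from glue_along_subdivision[OF h match] obtain H where H: "continuous_map (prod_topology ?I ?V) Z H \<and>
    (\<forall>j\<in>{1..<m}. \<forall>s\<in>{t j..t (Suc j)}. \<forall>w\<in>topspace ?V. H (s, w) = h j (s, w))" ..
  have Ht: "H (t i, w) = g i w" if i: "i \<in> {1..m}" and w: "w \<in> U" for i w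
  proof (cases "i < m")
    case True
    then show ?thesis using H h_left[of i w] t_le_iff[of i "Suc i"] i w U by auto
  next
    case False
    then obtain j where j: "i = Suc j" "j \<in> {1..<m}"
      using i two_le by (cases i) auto
    then show ?thesis using H h_right[of j w] t_le_iff[of j i] i w U by auto
  qed
  let ?q = "\<lambda>w. \<lambda>s\<in>{0..1}. H (s, w)"
  have "continuous_map ?V (dist_total t m W Z g) (\<lambda>w. (w, ?q w))"
    unfolding dist_total_def
  proof (rule continuous_map_into_pullback)
    show "continuous_map ?V W (\<lambda>w. w)" by (simp add: continuous_map_from_subtopology)
    show "continuous_map ?V (path_space Z) ?q"
      by (rule continuous_map_path_curry[OF conjunct1[OF H]])
    show "tuple_map m g w = eval_at m t (?q w)" if "w \<in> topspace ?V" for w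
      using that Ht t_unit by (auto simp: tuple_map_eq_eval_at_iff)
  qed
  then show ?sec by (intro exI[of _ "\<lambda>w. (w, ?q w)"]) auto
qed

lemma hdist_eq_secat: "hdist m W Z g = secat (dist_total t m W Z g) W fst"
proof -
  have "(openin W U \<and> (\<forall>i\<in>{1..m}. \<forall>j\<in>{1..m}. homotopic_with (\<lambda>_. True) (subtopology W U) Z (g i) (g j)))
    \<longleftrightarrow> (openin W U \<and> (\<exists>s. continuous_map (subtopology W U) (dist_total t m W Z g) s \<and> (\<forall>w\<in>U. fst (s w) = w)))" for U
    using section_of_dist_total_iff[of U W Z g] openin_subset[of W U] by blast
  then show ?thesis unfolding hdist_def secat_def by simp
qed

section \<open>Fibrewise comparison of the two pullbacks\<close>

lemma power_insert_pt:
  assumes "j \<in> {1..m}"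
  shows "(power_map m f \<circ> insert_pt m x0 i) x j =
    (if j < i then f (x j) else if j = i then f x0 else f (x (j - 1)))"
  using assms by (auto simp: power_map_def insert_pt_def)

text \<open>On \<open>[t\<^sub>j, t\<^sub>j\<^sub>+\<^sub>1]\<close> the new path follows \<open>\<Gamma>\<^sub>j\<^sub>+\<^sub>1\<close> from time \<open>t\<^sub>j\<close> to time \<open>t\<^sub>j\<^sub>+\<^sub>2\<close>, that is from \<open>f(x\<^sub>j)\<close> to \<open>f(x\<^sub>j\<^sub>+\<^sub>1)\<close>;
  for \<open>j = m - 1\<close> there is no \<open>t\<^sub>j\<^sub>+\<^sub>2\<close>, and stopping at \<open>t\<^sub>m\<close> yields the required end point \<open>y\<^sub>0\<close>.\<close>

lemma dist_total_to_cat_total: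
  fixes f x0 X Y
  defines "E \<equiv> dist_total t m (power_top (m - 1) X) (power_top m Y) (\<lambda>i. power_map m f \<circ> insert_pt m x0 i)"
  assumes y0: "f x0 = y0"
  obtains \<Phi> where "continuous_map E (cat_total t m X Y y0 f) \<Phi>"
    and "\<And>e. fst (\<Phi> e) = fst e"
proof -
  let ?I = "top_of_set {0..1::real}"
  let ?D = "prod_topology ?I E"
  \<comment> \<open>The time change \<open>\<psi>\<^sub>j\<close> stretches \<open>[t\<^sub>j, t\<^sub>j\<^sub>+\<^sub>1]\<close> to \<open>[t\<^sub>j, t\<^sub>j\<^sub>+\<^sub>2]\<close>; the minimum takes care of \<open>j = m - 1\<close>.\<close>
  have "\<exists>\<psi>. continuous_map ?I ?I \<psi> \<and> (\<forall>i\<in>{1..m}. \<psi> (t i) = t (if i \<le> j then i else min (Suc i) m))" for j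
  proof -
    have "0 \<le> t (if i \<le> j then i else min (Suc i) m) \<and> t (if i \<le> j then i else min (Suc i) m) \<le> 1"
      if "i \<in> {1..m}" for i
      using that by (intro t_unit) auto
    then show ?thesis
      using interpolate_on_subdivision[of "\<lambda>i. t (if i \<le> j then i else min (Suc i) m)"] by metis
  qed
  then obtain \<psi> where \<psi>: "\<And>j. continuous_map ?I ?I (\<psi> j)"
    "\<And>i j. i \<in> {1..m} \<Longrightarrow> \<psi> j (t i) = t (if i \<le> j then i else min (Suc i) m)"
    by metis
  define h where "h j z = snd (snd z) (\<psi> j (fst z)) (Suc j)"
    for j :: nat and z :: "real \<times> ((nat \<Rightarrow> 'a) \<times> (real \<Rightarrow> nat \<Rightarrow> 'b))"
  have h: "continuous_map ?D Y (h j)" if "j \<in> {1..<m}" for j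
  proof -
    have "continuous_map ?D (path_space (power_top m Y)) (snd \<circ> snd)"
      unfolding E_def dist_total_def
      by (rule continuous_map_compose[OF continuous_map_snd continuous_map_pullback_snd])
    moreover have "continuous_map ?D ?I (\<psi> j \<circ> fst)"
      using \<psi>(1) by (rule continuous_map_compose[OF continuous_map_fst])
    ultimately have "continuous_map ?D (power_top m Y) (\<lambda>z. (snd \<circ> snd) z ((\<psi> j \<circ> fst) z))"
      by (rule continuous_map_path_eval)
    moreover have "continuous_map (power_top m Y) Y (\<lambda>y. y (Suc j))"
      unfolding power_top_def using that
      by (intro continuous_map_product_projection) auto
    ultimately have "continuous_map ?D Y ((\<lambda>y. y (Suc j)) \<circ> (\<lambda>z. (snd \<circ> snd) z ((\<psi> j \<circ> fst) z)))"
      by (rule continuous_map_compose)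
    then show ?thesis by (simp add: o_def h_def[abs_def])
  qed
  have \<Gamma>: "\<Gamma> (t i) j = (if j < i then f (x j) else if j = i then y0 else f (x (j - 1)))"
    if "(x, \<Gamma>) \<in> topspace E" "i \<in> {1..m}" "j \<in> {1..m}" for x \<Gamma> i j
    using that power_insert_pt[of j f x0 i x] y0 by (auto simp: E_def topspace_dist_total)
  have h_left: "h j (t j, v) = f (fst v j)" if "j \<in> {1..<m}" "v \<in> topspace E" for j v
    using that \<Gamma>[of "fst v" "snd v" j "Suc j"] \<psi>(2)[of j j] by (auto simp: h_def)
  have h_right: "h j (t (Suc j), v) = f (fst v (Suc j))" if "1 \<le> j" "Suc j < m" "v \<in> topspace E" for j v
    using that \<Gamma>[of "fst v" "snd v" "Suc (Suc j)" "Suc j"] \<psi>(2)[of "Suc j" j] by (auto simp: h_def min_def)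
  have h_end: "h (m - 1) (1, v) = y0" if "v \<in> topspace E" for v
    using that \<Gamma>[of "fst v" "snd v" m m] \<psi>(2)[of m "m - 1"] two_le t_last by (auto simp: h_def min_def)
  have match: "h j (t (Suc j), v) = h (Suc j) (t (Suc j), v)"
    if "1 \<le> j" "Suc j < m" "v \<in> topspace E" for j v
    using h_left[of "Suc j" v] h_right[of j v] that by auto
  from glue_along_subdivision[OF h match] obtain H where H: "continuous_map ?D Y H \<and>
    (\<forall>j\<in>{1..<m}. \<forall>s\<in>{t j..t (Suc j)}. \<forall>v\<in>topspace E. H (s, v) = h j (s, v))" ..
  have Ht: "H (t j, v) = f (fst v j)" if "j \<in> {1..<m}" "v \<in> topspace E" for j v
    using H h_left[of j v] t_le_iff[of j "Suc j"] that by auto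
  have H1: "H (1, v) = y0" if "v \<in> topspace E" for v
  proof -
    have "m - 1 \<in> {1..<m}" "Suc (m - 1) = m" using two_le by auto
    then have "H (t m, v) = h (m - 1) (t m, v)"
      using H that t_le_iff[of "m - 1" m] two_le by auto
    then show ?thesis using h_end[OF that] t_last by simp
  qed
  let ?q = "\<lambda>v. \<lambda>s\<in>{0..1}. H (s, v)"
  have "continuous_map E (cat_total t m X Y y0 f) (\<lambda>v. (fst v, ?q v))"
    unfolding cat_total_def
  proof (rule continuous_map_into_pullback)
    show "continuous_map E (power_top (m - 1) X) fst"
      unfolding E_def dist_total_def by (rule continuous_map_pullback_fst)
    show "continuous_map E (path_space_to Y y0) ?q"
      unfolding path_space_to_def using H1
      by (auto intro!: continuous_map_into_subtopology continuous_map_path_curry[OF conjunct1[OF H]])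
    show "power_map (m - 1) f (fst v) = eval_at (m - 1) t (?q v)" if "v \<in> topspace E" for v
      unfolding power_map_eq_eval_at_iff
    proof
      fix i assume "i \<in> {1..m - 1}"
      then have "i \<in> {1..<m}" by auto
      then show "?q v (t i) = f (fst v i)" using Ht[of i v] t_unit[of i] that by simp
    qed
  qed
  then show thesis by (rule that) auto
qed

text \<open>The \<open>j\<close>-th coordinate of \<open>\<Gamma>\<close> must be \<open>f(x\<^sub>j\<^sub>-\<^sub>1)\<close>, \<open>y\<^sub>0\<close>, \<open>f(x\<^sub>j)\<close> at times \<open>t\<^sub>i\<close> with \<open>i < j\<close>, \<open>i = j\<close>, \<open>i > j\<close>. These are the
  values of \<open>\<gamma>\<close> at \<open>t\<^sub>j\<^sub>-\<^sub>1\<close>, \<open>t\<^sub>m\<close>, \<open>t\<^sub>j\<close>, so the coordinate is \<open>\<gamma>\<close> after a time change.\<close>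

lemma cat_total_to_dist_total:
  fixes f x0 X Y
  defines "E \<equiv> dist_total t m (power_top (m - 1) X) (power_top m Y) (\<lambda>i. power_map m f \<circ> insert_pt m x0 i)"
  assumes y0: "f x0 = y0"
  obtains \<Psi> where "continuous_map (cat_total t m X Y y0 f) E \<Psi>"
    and "\<And>e. fst (\<Psi> e) = fst e"
proof -
  let ?I = "top_of_set {0..1::real}"
  let ?C = "cat_total t m X Y y0 f"
  let ?D = "prod_topology ?I ?C"
  \<comment> \<open>At time \<open>t\<^sub>j\<close> the value must be \<open>t\<^sub>m = 1\<close>, where \<open>\<gamma>\<close> reaches \<open>y\<^sub>0\<close>.\<close>
  have "\<exists>\<phi>. continuous_map ?I ?I \<phi> \<and>
      (\<forall>i\<in>{1..m}. \<phi> (t i) = t (if j < i then j else if j = i then m else j - 1))" if "j \<in> {1..m}" for j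
  proof -
    have "0 \<le> t (if j < i then j else if j = i then m else j - 1) \<and>
      t (if j < i then j else if j = i then m else j - 1) \<le> 1" if "i \<in> {1..m}" for i
      using that \<open>j \<in> {1..m}\<close> by (intro t_unit) auto
    then show ?thesis
      using interpolate_on_subdivision[of "\<lambda>i. t (if j < i then j else if j = i then m else j - 1)"] by metis
  qed
  then obtain \<phi> where \<phi>: "\<And>j. j \<in> {1..m} \<Longrightarrow> continuous_map ?I ?I (\<phi> j)"
    "\<And>i j. j \<in> {1..m} \<Longrightarrow> i \<in> {1..m} \<Longrightarrow>
      \<phi> j (t i) = t (if j < i then j else if j = i then m else j - 1)"
    by metis
  define H where "H z = (\<lambda>j\<in>{1..m}. snd (snd z) (\<phi> j (fst z)))"
    for z :: "real \<times> ((nat \<Rightarrow> 'a) \<times> (real \<Rightarrow> 'b))"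
  have H: "continuous_map ?D (power_top m Y) H"
    unfolding power_top_def continuous_map_componentwise
  proof (intro conjI ballI)
    show "H ` topspace ?D \<subseteq> extensional {1..m}" by (auto simp: H_def)
    fix j assume j: "j \<in> {1..m}"
    have "continuous_map ?D (path_space_to Y y0) (snd \<circ> snd)"
      unfolding cat_total_def
      by (rule continuous_map_compose[OF continuous_map_snd continuous_map_pullback_snd])
    then have "continuous_map ?D (path_space Y) (snd \<circ> snd)"
      unfolding path_space_to_def by (rule continuous_map_into_fulltopology)
    moreover have "continuous_map ?D ?I (\<phi> j \<circ> fst)"
      using \<phi>(1)[OF j] by (rule continuous_map_compose[OF continuous_map_fst])
    ultimately have "continuous_map ?D Y (\<lambda>z. (snd \<circ> snd) z ((\<phi> j \<circ> fst) z))"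
      by (rule continuous_map_path_eval)
    then show "continuous_map ?D Y (\<lambda>z. H z j)" using j by (simp add: H_def)
  qed
  have Ht: "H (t i, v) = (power_map m f \<circ> insert_pt m x0 i) (fst v)"
    if i: "i \<in> {1..m}" and v: "v \<in> topspace ?C" for i v
  proof
    fix j
    show "H (t i, v) j = (power_map m f \<circ> insert_pt m x0 i) (fst v) j"
    proof (cases "j \<in> {1..m}")
      case True
      have val: "snd v (t k) = f (fst v k)" if "k \<in> {1..m - 1}" for k
        using v that by (auto simp: topspace_cat_total)
      have "snd v (t j) = f (fst v j)" if "j < i"
        by (rule val) (use that True i in auto)
      moreover have "snd v (t (j - 1)) = f (fst v (j - 1))" if "i < j"
        by (rule val) (use that True i in auto)
      moreover have "snd v (t m) = f x0"
        using v y0 t_last by (auto simp: topspace_cat_total)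
      ultimately show ?thesis
        unfolding power_insert_pt[OF True] using True i \<phi>(2)[OF True i] by (auto simp: H_def)
    qed (auto simp: H_def power_map_def)
  qed
  let ?q = "\<lambda>v. \<lambda>s\<in>{0..1}. H (s, v)"
  have "continuous_map ?C E (\<lambda>v. (fst v, ?q v))"
    unfolding E_def dist_total_def
  proof (rule continuous_map_into_pullback)
    show "continuous_map ?C (power_top (m - 1) X) fst"
      unfolding cat_total_def by (rule continuous_map_pullback_fst)
    show "continuous_map ?C (path_space (power_top m Y)) ?q"
      using H by (rule continuous_map_path_curry)
    show "tuple_map m (\<lambda>i. power_map m f \<circ> insert_pt m x0 i) (fst v) = eval_at m t (?q v)"
      if "v \<in> topspace ?C" for v
      using that Ht t_unit by (auto simp: tuple_map_eq_eval_at_iff)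
  qed
  then show thesis by (rule that) auto
qed

lemma cat_power_eq_hdist:
  assumes "f x0 = y0"
  shows "cat_power t m X Y y0 f =
    hdist m (power_top (m - 1) X) (power_top m Y) (\<lambda>i. power_map m f \<circ> insert_pt m x0 i)"
  unfolding cat_power_def hdist_eq_secat
proof (rule order.antisym)
  let ?E = "dist_total t m (power_top (m - 1) X) (power_top m Y) (\<lambda>i. power_map m f \<circ> insert_pt m x0 i)"
  show "secat (cat_total t m X Y y0 f) (power_top (m - 1) X) fst \<le> secat ?E (power_top (m - 1) X) fst"
    by (rule dist_total_to_cat_total[where f = f and X = X and Y = Y, OF assms]) (erule secat_fibrewise_mono)
  show "secat ?E (power_top (m - 1) X) fst \<le> secat (cat_total t m X Y y0 f) (power_top (m - 1) X) fst"
    by (rule cat_total_to_dist_total[where f = f and X = X and Y = Y, OF assms]) (erule secat_fibrewise_mono)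
qed

lemma dcat_power_eq_dhdist:
  fixes f X Y x0
  defines "E \<equiv> dist_total t m (power_top (m - 1) X) (power_top m Y) (\<lambda>i. power_map m f \<circ> insert_pt m x0 i)"
  assumes y0: "f x0 = y0"
    and adm: "admissible \<tau> (cat_total t m X Y y0 f)" "admissible \<tau> E"
  shows "dcat_power \<tau> t m X Y y0 f =
    dhdist \<tau> t m (power_top (m - 1) X) (power_top m Y) (\<lambda>i. power_map m f \<circ> insert_pt m x0 i)"
  unfolding dcat_power_def dhdist_def E_def[symmetric]
proof (rule order.antisym)
  obtain \<Phi> where "continuous_map E (cat_total t m X Y y0 f) \<Phi>" "\<And>e. fst (\<Phi> e) = fst e"
    using dist_total_to_cat_total[where f = f and X = X and Y = Y, OF y0] unfolding E_def by blast
  then show "dsecat \<tau> (cat_total t m X Y y0 f) (power_top (m - 1) X) fst \<le> dsecat \<tau> E (power_top (m - 1) X) fst"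
    using adm(2,1) by (rule dsecat_fibrewise_mono)
  obtain \<Psi> where "continuous_map (cat_total t m X Y y0 f) E \<Psi>" "\<And>e. fst (\<Psi> e) = fst e"
    using cat_total_to_dist_total[where f = f and X = X and Y = Y, OF y0] unfolding E_def by blast
  then show "dsecat \<tau> E (power_top (m - 1) X) fst \<le> dsecat \<tau> (cat_total t m X Y y0 f) (power_top (m - 1) X) fst"
    using adm by (rule dsecat_fibrewise_mono)
qed

end

lemma power_map_id_insert_pt: "power_map m id \<circ> insert_pt m x0 i = insert_pt m x0 i"
  by (auto simp: power_map_def insert_pt_def restrict_def fun_eq_iff)

theorem proposition3p4:
  fixes X :: "'a topology" and Y :: "'b topology" and x0 :: 'a and y0 :: 'b
    and f :: "'a \<Rightarrow> 'b" and m :: nat and t :: "nat \<Rightarrow> real"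
  assumes "m \<ge> 2"
    and "t 1 = 0" and "t m = 1" and "strict_mono_on {1..m} t"
    and "x0 \<in> topspace X" and "y0 \<in> topspace Y"
    and "continuous_map X Y f" and "f x0 = y0"
  shows
    "cat_power t m X Y y0 f
       \<le> hdist m (power_top (m - 1) X) (power_top m Y) (\<lambda>i. power_map m f \<circ> insert_pt m x0 i)
     \<and> (\<forall>\<tau>. admissible \<tau> (cat_total t m X Y y0 f) \<and>
            admissible \<tau> (dist_total t m (power_top (m - 1) X) (power_top m Y)
                            (\<lambda>i. power_map m f \<circ> insert_pt m x0 i))
          \<longrightarrow> dcat_power \<tau> t m X Y y0 f
              \<le> dhdist \<tau> t m (power_top (m - 1) X) (power_top m Y)
                  (\<lambda>i. power_map m f \<circ> insert_pt m x0 i))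
     \<and> cat_power t m X X x0 id
       = hdist m (power_top (m - 1) X) (power_top m X) (insert_pt m x0)
     \<and> (\<forall>\<tau>. admissible \<tau> (cat_total t m X X x0 id) \<and>
            admissible \<tau> (dist_total t m (power_top (m - 1) X) (power_top m X) (insert_pt m x0))
          \<longrightarrow> dcat_power \<tau> t m X X x0 id
              = dhdist \<tau> t m (power_top (m - 1) X) (power_top m X) (insert_pt m x0))"
proof -
  interpret unit_partition m t
    using assms by unfold_locales
  have y0: "f x0 = y0" by fact
  have x0: "id x0 = x0" by simp
  show ?thesis
    using cat_power_eq_hdist[of f, OF y0] dcat_power_eq_dhdist[of f, OF y0]
      cat_power_eq_hdist[of id, OF x0, where X = X and Y = X] dcat_power_eq_dhdist[of id, OF x0, where X = X and Y = X]
    unfolding power_map_id_insert_pt by auto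
qed

end
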